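(* Let $(R,\mathfrak m)$ be a Noetherian local ring of prime characteristic $p>0$, let $M$ be a finitely generated $R$-module, and let $N$ be any submodule of $M$. Then for any minimal $F$-reduction $L$ of $N$ in $M$, the minimal number of generators of $L$ is equal to the eventual minimal number of generators of the modules $N^{[q]}_M$ for large enough powers $q$ of $p$ (i.e. $\mu(L)=\mu(N^{[q]}_M)$ for all sufficiently large powers $q$ of $p$). Hence Frobenius closure has spread: any two minimal $F$-reductions of $N$ in $M$ have the same minimal number of generators.
   Context: For $e\ge 0$ and $q=p^e$, let $F^e(M)$ denote the base change of $M$ along the $e$-th iterate of the Frobenius endomorphism of $R$. For $z\in M$ let $z^q:=1\otimes z\in F^e(M)$. For a submodule $N\subseteq M$, let $N^{[q]}_M$ be the $R$-submodule of $F^e(M)$ generated by $\{z^q : z\in N\}$. The Frobenius closure is $N^F_M=\{z\in M : z^q\in N^{[q]}_M \text{ for some } q=p^e\}$. A submodule $L\subseteq N$ is an $F$-reduction of $N$ in $M$ if $L^F_M=N^F_M$; it is minimal if no proper submodule of $L$ is an $F$-reduction of $N$. $\mu(-)$ denotes the minimal number of generators of a finitely generated $R$-module. *)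

theory Defs
  imports "HOL-Algebra.Algebra" "HOL-Algebra.Free_Abelian_Groups"
begin

section \<open>Local rings and the characteristic\<close>

definition local_ring :: "('a, 'b) ring_scheme \<Rightarrow> 'a set \<Rightarrow> bool" where
  "local_ring R \<mm> \<longleftrightarrow> cring R \<and> maximalideal \<mm> R \<and> (\<forall>I. maximalideal I R \<longrightarrow> I = \<mm>)"

text \<open>The carrier-based counterpart of \<^const>\<open>semiring_char\<close>.\<close>

definition ring_char :: "('a, 'b) ring_scheme \<Rightarrow> nat" where
  "ring_char R = Gcd {n :: nat. [n] \<cdot>\<^bsub>R\<^esub> \<one>\<^bsub>R\<^esub> = \<zero>\<^bsub>R\<^esub>}"


section \<open>Generated submodules and numbers of generators\<close>

definition submodule_gen ::
  "('a, 'b) ring_scheme \<Rightarrow> ('a, 'm, 'c) module_scheme \<Rightarrow> 'm set \<Rightarrow> 'm set" where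
  "submodule_gen R M A = (\<lambda>H. submodule H R M) hull A"

definition fin_gen ::
  "('a, 'b) ring_scheme \<Rightarrow> ('a, 'm, 'c) module_scheme \<Rightarrow> 'm set \<Rightarrow> bool" where
  "fin_gen R M N \<longleftrightarrow> (\<exists>A. A \<subseteq> N \<and> finite A \<and> submodule_gen R M A = N)"

text \<open>The number \<open>\<mu>(N)\<close> of a submodule \<open>N\<close> of \<open>M\<close>; unspecified unless \<open>N\<close> is finitely
  generated.\<close>

definition min_num_gens ::
  "('a, 'b) ring_scheme \<Rightarrow> ('a, 'm, 'c) module_scheme \<Rightarrow> 'm set \<Rightarrow> nat" where
  "min_num_gens R M N =
     (LEAST n. \<exists>A. A \<subseteq> N \<and> finite A \<and> card A = n \<and> submodule_gen R M A = N)"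


section \<open>Base change of modules\<close>

text \<open>
  The base change of an \<open>R\<close>-module \<open>M\<close> along \<open>\<phi> : R \<rightarrow> S\<close> is the tensor product of \<open>S\<close> and \<open>M\<close>
  over \<open>R\<close>, where \<open>S\<close> is an \<open>R\<close>-module via \<open>\<phi>\<close>. It is built as the quotient of the free abelian
  group on pairs \<open>(s, x)\<close> by the usual relations, and \<open>S\<close> acts on the left factor.
\<close>

definition base_change_rels ::
  "('a, 'b) ring_scheme \<Rightarrow> ('s, 't) ring_scheme \<Rightarrow> ('a \<Rightarrow> 's) \<Rightarrow> ('a, 'm, 'c) module_scheme
    \<Rightarrow> ('s \<times> 'm \<Rightarrow>\<^sub>0 int) set" where
  "base_change_rels R S \<phi> M =
     {frag_of (s \<oplus>\<^bsub>S\<^esub> t, x) - (frag_of (s, x) + frag_of (t, x)) | s t x.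
        s \<in> carrier S \<and> t \<in> carrier S \<and> x \<in> carrier M} \<union>
     {frag_of (s, x \<oplus>\<^bsub>M\<^esub> y) - (frag_of (s, x) + frag_of (s, y)) | s x y.
        s \<in> carrier S \<and> x \<in> carrier M \<and> y \<in> carrier M} \<union>
     {frag_of (s \<otimes>\<^bsub>S\<^esub> \<phi> r, x) - frag_of (s, r \<odot>\<^bsub>M\<^esub> x) | s r x.
        s \<in> carrier S \<and> r \<in> carrier R \<and> x \<in> carrier M}"

definition base_change_free ::
  "('s, 't) ring_scheme \<Rightarrow> ('a, 'm, 'c) module_scheme \<Rightarrow> ('s \<times> 'm \<Rightarrow>\<^sub>0 int) monoid" where
  "base_change_free S M = free_Abelian_group (carrier S \<times> carrier M)"

definition base_change_null ::
  "('a, 'b) ring_scheme \<Rightarrow> ('s, 't) ring_scheme \<Rightarrow> ('a \<Rightarrow> 's) \<Rightarrow> ('a, 'm, 'c) module_scheme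
    \<Rightarrow> ('s \<times> 'm \<Rightarrow>\<^sub>0 int) set" where
  "base_change_null R S \<phi> M = generate (base_change_free S M) (base_change_rels R S \<phi> M)"

definition base_change_tensor ::
  "('a, 'b) ring_scheme \<Rightarrow> ('s, 't) ring_scheme \<Rightarrow> ('a \<Rightarrow> 's) \<Rightarrow> ('a, 'm, 'c) module_scheme
    \<Rightarrow> 's \<Rightarrow> 'm \<Rightarrow> ('s \<times> 'm \<Rightarrow>\<^sub>0 int) set" where
  "base_change_tensor R S \<phi> M s x =
     base_change_null R S \<phi> M #>\<^bsub>base_change_free S M\<^esub> frag_of (s, x)"

text \<open>The scalar \<open>s\<close> acts on free generators by \<open>(t, x) \<mapsto> (s t, x)\<close>. A coset \<open>C\<close> is sent to the
  coset containing the images of its elements; the union merges equal cosets. The ring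
  multiplication inherited by the module record is irrelevant.\<close>

definition base_change_act ::
  "('s, 't) ring_scheme \<Rightarrow> 's \<Rightarrow> ('s \<times> 'm \<Rightarrow>\<^sub>0 int) \<Rightarrow> ('s \<times> 'm \<Rightarrow>\<^sub>0 int)" where
  "base_change_act S s = frag_extend (\<lambda>(t, x). frag_of (s \<otimes>\<^bsub>S\<^esub> t, x))"

definition base_change ::
  "('a, 'b) ring_scheme \<Rightarrow> ('s, 't) ring_scheme \<Rightarrow> ('a \<Rightarrow> 's) \<Rightarrow> ('a, 'm, 'c) module_scheme
    \<Rightarrow> ('s, ('s \<times> 'm \<Rightarrow>\<^sub>0 int) set) module" where
  "base_change R S \<phi> M =
     (let G = base_change_free S M; K = base_change_null R S \<phi> M
      in \<lparr>carrier = carrier (G Mod K), monoid.mult = undefined, monoid.one = undefined,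
          ring.zero = \<one>\<^bsub>G Mod K\<^esub>, ring.add = monoid.mult (G Mod K),
          module.smult = (\<lambda>s C. \<Union>c\<in>C. K #>\<^bsub>G\<^esub> base_change_act S s c)\<rparr>)"


section \<open>Frobenius powers, Frobenius closure and F-reductions\<close>

text \<open>The argument \<open>p\<close> is the characteristic of \<open>R\<close>, and the exponent \<open>e\<close> stands for \<open>q = p ^ e\<close>.\<close>

definition frobenius :: "('a, 'b) ring_scheme \<Rightarrow> nat \<Rightarrow> 'a \<Rightarrow> 'a" where
  "frobenius R p = (\<lambda>r. r [^]\<^bsub>R\<^esub> p)"

definition frob_module ::
  "('a, 'b) ring_scheme \<Rightarrow> nat \<Rightarrow> nat \<Rightarrow> ('a, 'm, 'c) module_scheme
    \<Rightarrow> ('a, ('a \<times> 'm \<Rightarrow>\<^sub>0 int) set) module" where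
  "frob_module R p e M = base_change R R (frobenius R p ^^ e) M"

definition frob_elem ::
  "('a, 'b) ring_scheme \<Rightarrow> nat \<Rightarrow> nat \<Rightarrow> ('a, 'm, 'c) module_scheme
    \<Rightarrow> 'm \<Rightarrow> ('a \<times> 'm \<Rightarrow>\<^sub>0 int) set" where
  "frob_elem R p e M z = base_change_tensor R R (frobenius R p ^^ e) M \<one>\<^bsub>R\<^esub> z"

definition frob_power ::
  "('a, 'b) ring_scheme \<Rightarrow> nat \<Rightarrow> nat \<Rightarrow> ('a, 'm, 'c) module_scheme
    \<Rightarrow> 'm set \<Rightarrow> ('a \<times> 'm \<Rightarrow>\<^sub>0 int) set set" where
  "frob_power R p e M N = submodule_gen R (frob_module R p e M) (frob_elem R p e M ` N)"

definition frob_closure ::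
  "('a, 'b) ring_scheme \<Rightarrow> nat \<Rightarrow> ('a, 'm, 'c) module_scheme \<Rightarrow> 'm set \<Rightarrow> 'm set" where
  "frob_closure R p M N =
     {z \<in> carrier M. \<exists>e. frob_elem R p e M z \<in> frob_power R p e M N}"

definition F_reduction ::
  "('a, 'b) ring_scheme \<Rightarrow> nat \<Rightarrow> ('a, 'm, 'c) module_scheme \<Rightarrow> 'm set \<Rightarrow> 'm set \<Rightarrow> bool" where
  "F_reduction R p M N L \<longleftrightarrow>
     submodule L R M \<and> L \<subseteq> N \<and> frob_closure R p M L = frob_closure R p M N"

definition minimal_F_reduction ::
  "('a, 'b) ring_scheme \<Rightarrow> nat \<Rightarrow> ('a, 'm, 'c) module_scheme \<Rightarrow> 'm set \<Rightarrow> 'm set \<Rightarrow> bool" where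
  "minimal_F_reduction R p M N L \<longleftrightarrow>
     F_reduction R p M N L \<and>
     (\<forall>L'. submodule L' R M \<and> L' \<subset> L \<longrightarrow> \<not> F_reduction R p M N L')"

end

theory Submission
  imports Defs
begin

text \<open>If \<open>L\<close> is an \<open>F\<close>-reduction of \<open>N\<close>, then each of the finitely many generators of \<open>N\<close> has
  some Frobenius power in \<open>L\<^sup>[\<^sup>q\<^sup>]\<close>, so \<open>N\<^sup>[\<^sup>q\<^sup>] = L\<^sup>[\<^sup>q\<^sup>]\<close> for large \<open>q\<close>; hence it suffices that
  \<open>\<mu>(L\<^sup>[\<^sup>q\<^sup>]) = \<mu>(L)\<close> for all \<open>q\<close>. If \<open>x\<^sub>1, \<dots>, x\<^sub>n\<close> generate \<open>L\<close>, their \<open>q\<close>-th powers generate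
  \<open>L\<^sup>[\<^sup>q\<^sup>]\<close>, and over a local ring some \<open>\<mu>(L\<^sup>[\<^sup>q\<^sup>])\<close> of these powers already do. The corresponding
  \<open>x\<^sub>i\<close> generate a submodule \<open>L'\<close> of \<open>L\<close> with \<open>L'\<^sup>[\<^sup>q\<^sup>] = L\<^sup>[\<^sup>q\<^sup>]\<close>, hence with the same Frobenius closure,
  and minimality forces \<open>L' = L\<close>.\<close>

section \<open>Local rings and prime characteristic\<close>

text \<open>The binomial theorem over a carrier, needed for additivity of the Frobenius map.
  Multiplying the expansion for \<open>n\<close> by \<open>a\<close> and by \<open>b\<close> gives
  two sums, which Pascal's rule merges after a shift of the index.\<close>

lemma (in cring) binomial_finsum:
  assumes a: "a \<in> carrier R" and b: "b \<in> carrier R"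
  shows "(a \<oplus> b) [^] (n::nat) = (\<Oplus>k\<in>{..n}. add_pow R (n choose k) (a [^] k \<otimes> b [^] (n - k)))"
proof (induction n)
  case 0
  then show ?case using a b by simp
next
  case (Suc n)
  define f where "f k = a [^] Suc k \<otimes> b [^] (n - k)" for k
  define g where "g k = a [^] k \<otimes> b [^] (Suc n - k)" for k
  have fc[simp]: "f k \<in> carrier R" and gc[simp]: "g k \<in> carrier R" for k
    using a b by (auto simp: f_def g_def)
  have fg: "g (Suc k) = f k" for k by (simp add: f_def g_def)
  have "(a \<oplus> b) [^] Suc n
      = (\<Oplus>k\<in>{..n}. add_pow R (n choose k) (a [^] k \<otimes> b [^] (n - k))) \<otimes> a
        \<oplus> (\<Oplus>k\<in>{..n}. add_pow R (n choose k) (a [^] k \<otimes> b [^] (n - k))) \<otimes> b"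
    using a b Suc.IH by (simp add: r_distr)
  also have "(\<Oplus>k\<in>{..n}. add_pow R (n choose k) (a [^] k \<otimes> b [^] (n - k))) \<otimes> a
      = (\<Oplus>k\<in>{..n}. add_pow R (n choose k) (f k))"
    using a b by (subst finsum_ldistr) (auto simp: add_pow_ldistr add_pow_rdistr f_def m_ac intro!: finsum_cong')
  also have "(\<Oplus>k\<in>{..n}. add_pow R (n choose k) (a [^] k \<otimes> b [^] (n - k))) \<otimes> b
      = (\<Oplus>k\<in>{..n}. add_pow R (n choose k) (g k))"
    using a b by (subst finsum_ldistr) (auto simp: add_pow_ldistr add_pow_rdistr g_def m_ac Suc_diff_le intro!: finsum_cong')
  \<comment> \<open>The added top term vanishes, as \<open>n choose Suc n\<close> is zero. The
    bottom term \<open>g 0\<close> is split off next, so that both sums run over the products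
    \<open>f k\<close> and Pascal's rule applies.\<close>
  also have "(\<Oplus>k\<in>{..n}. add_pow R (n choose k) (g k)) = (\<Oplus>k\<in>{..Suc n}. add_pow R (n choose k) (g k))"
    by (simp add: finsum_Suc binomial_eq_0)
  also have "\<dots> = (\<Oplus>k\<in>{..n}. add_pow R (n choose Suc k) (f k)) \<oplus> g 0"
    by (subst finsum_Suc2) (auto simp: fg)
  also have "(\<Oplus>k\<in>{..n}. add_pow R (n choose k) (f k)) \<oplus> \<dots>
      = ((\<Oplus>k\<in>{..n}. add_pow R (n choose k) (f k)) \<oplus> (\<Oplus>k\<in>{..n}. add_pow R (n choose Suc k) (f k))) \<oplus> g 0"
    by (subst a_assoc) (auto intro!: finsum_closed)
  also have "(\<Oplus>k\<in>{..n}. add_pow R (n choose k) (f k)) \<oplus> (\<Oplus>k\<in>{..n}. add_pow R (n choose Suc k) (f k))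
      = (\<Oplus>k\<in>{..n}. add_pow R (Suc n choose Suc k) (f k))"
    by (subst finsum_addf[symmetric]) (auto simp: add.nat_pow_mult intro!: finsum_cong')
  also have "\<dots> \<oplus> g 0 = (\<Oplus>k\<in>{..Suc n}. add_pow R (Suc n choose k) (g k))"
    by (subst finsum_Suc2) (auto simp: fg)
  finally show ?case by (simp add: g_def)
qed

text \<open>Since \<open>ring_char\<close> is a gcd, it must first be seen to lie in the set
  \<open>S\<close> of integers killing \<open>\<one>\<close>. A positive gcd forces a positive
  element of \<open>S\<close>; the least such element divides every other one, because the remainder
  of the division lies in \<open>S\<close> again.\<close>

lemma (in cring) ring_char_annihilates:
  assumes "ring_char R > 0" and x: "x \<in> carrier R"
  shows "add_pow R (ring_char R) x = \<zero>"
proof -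
  define S where "S = {n :: nat. add_pow R n \<one> = \<zero>}"
  have G: "ring_char R = Gcd S" by (simp add: ring_char_def S_def)
  have "\<exists>n>0. n \<in> S"
  proof (rule ccontr)
    assume "\<not> ?thesis"
    then have "S \<subseteq> {0}" by auto
    then show False using assms G by (metis Gcd_0_iff less_irrefl)
  qed
  then obtain d where d: "d > 0" "d \<in> S" and least: "\<And>n. 0 < n \<Longrightarrow> n \<in> S \<Longrightarrow> d \<le> n"
    using exists_least_iff[of "\<lambda>n. 0 < n \<and> n \<in> S"] by (auto simp: not_less[symmetric])
  have "d dvd n" if "n \<in> S" for n
  proof -
    have "add_pow R n \<one> = add_pow R (d * (n div d)) \<one> \<oplus> add_pow R (n mod d) \<one>"
      by (subst add.nat_pow_mult) auto
    also have "add_pow R (d * (n div d)) \<one> = \<zero>"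
      using d by (simp add: add.nat_pow_pow[symmetric] S_def)
    finally have "n mod d \<in> S" using that by (simp add: S_def)
    then show "d dvd n" using least[of "n mod d"] d(1) by (metis mod_less_divisor mod_eq_0_iff_dvd not_le neq0_conv)
  qed
  then have "Gcd S = d" using d by (metis Gcd_dvd Gcd_greatest dvd_antisym)
  then have "add_pow R (ring_char R) \<one> = \<zero>" using d G by (simp add: S_def)
  then show ?thesis using add_pow_ldistr[of \<one> x "ring_char R"] x by simp
qed

text \<open>In the binomial expansion all coefficients except the two outer ones are divisible by
  \<open>p\<close>, so the terms with these coefficients vanish.\<close>

lemma (in cring) frobenius_add:
  assumes p: "Factorial_Ring.prime p" and ch: "ring_char R = p"
    and a: "a \<in> carrier R" and b: "b \<in> carrier R"
  shows "frobenius R p (a \<oplus> b) = frobenius R p a \<oplus> frobenius R p b"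
proof -
  \<comment> \<open>With \<open>p = m + 2\<close> the inner indices \<open>1, ..., p - 1\<close> are
    exactly \<open>Suc i\<close> for \<open>i \<le> m\<close>.\<close>
  obtain m where m: "p = Suc (Suc m)"
    using prime_ge_2_nat[OF p] by (metis add_2_eq_Suc le_Suc_ex)
  define f where "f k = add_pow R (p choose k) (a [^] k \<otimes> b [^] (p - k))" for k
  have fc[simp]: "f k \<in> carrier R" for k using a b by (simp add: f_def)
  have mid: "f (Suc i) = \<zero>" if "i \<in> {..m}" for i
  proof -
    have "p dvd (p choose Suc i)" using that m by (intro dvd_choose_prime p) auto
    then obtain c where "p choose Suc i = p * c" by blast
    then show ?thesis
      using a b ring_char_annihilates[of "a [^] Suc i \<otimes> b [^] (p - Suc i)"] prime_gt_0_nat[OF p] ch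
      by (simp add: f_def add.nat_pow_pow[symmetric])
  qed
  have "(a \<oplus> b) [^] p = (\<Oplus>k\<in>{..p}. f k)"
    using binomial_finsum[OF a b, of p] by (simp add: f_def)
  also have "\<dots> = f p \<oplus> ((\<Oplus>i\<in>{..m}. f (Suc i)) \<oplus> f 0)"
    unfolding m by (subst finsum_Suc) (auto simp: finsum_Suc2 simp del: finsum_Suc)
  also have "(\<Oplus>i\<in>{..m}. f (Suc i)) = \<zero>"
    by (rule add.finprod_one_eqI[OF mid])
  finally show ?thesis using a b by (simp add: f_def frobenius_def)
qed

text \<open>A nonunit generates a proper ideal, Zorn's lemma enlarges it to a maximal ideal, and
  \<open>\<mm>\<close> is the only one.\<close>

lemma (in noetherian_ring) local_ring_UnitsI:
  assumes L: "local_ring R \<mm>"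
    and a: "a \<in> carrier R" "a \<notin> \<mm>"
  shows "a \<in> Units R"
proof (rule ccontr)
  interpret cring R using L by (simp add: local_ring_def)
  assume nu: "a \<notin> Units R"
  define S where "S = {I. ideal I R \<and> a \<in> I \<and> \<one> \<notin> I}"
  have S0: "PIdl a \<in> S"
  proof -
    have "\<one> \<notin> PIdl a"
      using nu a(1) by (auto simp: cgenideal_def Units_def m_comm)
    then show ?thesis using a(1) by (simp add: S_def cgenideal_ideal cgenideal_self)
  qed
  have "\<exists>J\<in>S. \<forall>Y\<in>S. J \<subseteq> Y \<longrightarrow> Y = J"
  proof (rule subset_Zorn)
    fix C assume C: "subset.chain S C"
    show "\<exists>U\<in>S. \<forall>Y\<in>C. Y \<subseteq> U"
    proof (cases "C = {}")
      case False
      have "subset.chain {I. ideal I R} C"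
        using C by (auto simp: subset.chain_def S_def)
      \<comment> \<open>The Noetherian condition puts the union of a nonempty chain of ideals into
        the chain itself, so that it is an upper bound in \<open>S\<close>.\<close>
      then have "\<Union>C \<in> C" using ideal_chain_is_trivial False by blast
      then show ?thesis using C by (auto simp: subset.chain_def)
    qed (use S0 in auto)
  qed
  then obtain J where J: "J \<in> S" and max: "\<And>Y. Y \<in> S \<Longrightarrow> J \<subseteq> Y \<Longrightarrow> Y = J" by blast
  have "maximalideal J R"
  proof (rule maximalidealI)
    show "ideal J R" "carrier R \<noteq> J" using J by (auto simp: S_def)
    fix Y assume Y: "ideal Y R" "J \<subseteq> Y" "Y \<subseteq> carrier R"
    show "Y = J \<or> Y = carrier R"
      using max[of Y] J Y ideal.one_imp_carrier[OF Y(1)] by (auto simp: S_def)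
  qed
  then show False using L J a by (auto simp: local_ring_def S_def)
qed

section \<open>Generators of submodules\<close>

context module
begin

lemma submodule_zero: "submodule H R M \<Longrightarrow> \<zero>\<^bsub>M\<^esub> \<in> H"
  by (simp add: submodule_def subgroup_def)

lemma submodule_gen_submodule:
  assumes A: "A \<subseteq> carrier M"
  shows "submodule (submodule_gen R M A) R M"
proof (rule submoduleI)
  show "submodule_gen R M A \<subseteq> carrier M"
    unfolding submodule_gen_def using A carrier_is_submodule by (rule hull_minimal)
qed (auto simp: submodule_gen_def hull_def submodule_zero submoduleE)

lemma submodule_gen_minimal:
  "A \<subseteq> H \<Longrightarrow> submodule H R M \<Longrightarrow> submodule_gen R M A \<subseteq> H"
  unfolding submodule_gen_def by (rule hull_minimal)

lemma submodule_gen_superset: "A \<subseteq> submodule_gen R M A"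
  unfolding submodule_gen_def by (rule hull_subset)

lemma submodule_gen_mono: "A \<subseteq> B \<Longrightarrow> submodule_gen R M A \<subseteq> submodule_gen R M B"
  unfolding submodule_gen_def by (rule hull_mono)

lemma submodule_minus:
  assumes "submodule H R M" "x \<in> H" "y \<in> H"
  shows "x \<ominus>\<^bsub>M\<^esub> y \<in> H"
  using submoduleE(3,5)[OF assms(1)] assms by (simp add: a_minus_def)

lemma submodule_Int:
  assumes "submodule H R M" "submodule K R M"
  shows "submodule (H \<inter> K) R M"
  using assms submoduleE[OF assms(1)] submoduleE[OF assms(2)] submodule_zero
  by (intro submoduleI) auto

text \<open>The submodule \<open>W + I b\<close>. The ideal \<open>I\<close> is kept variable
  because \<open>I = carrier R\<close> describes adjoining the generator \<open>b\<close>, while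
  \<open>I = \<mm>\<close> occurs in the exchange argument.\<close>

definition add_multiples :: "'c set \<Rightarrow> 'a set \<Rightarrow> 'c \<Rightarrow> 'c set" where
  "add_multiples W I b = {w \<oplus>\<^bsub>M\<^esub> c \<odot>\<^bsub>M\<^esub> b | w c. w \<in> W \<and> c \<in> I}"

lemma add_multiplesI: "w \<in> W \<Longrightarrow> c \<in> I \<Longrightarrow> w \<oplus>\<^bsub>M\<^esub> c \<odot>\<^bsub>M\<^esub> b \<in> add_multiples W I b"
  by (auto simp: add_multiples_def)

lemma add_multiples_submodule:
  assumes W: "submodule W R M" and I: "ideal I R" and b: "b \<in> carrier M"
  shows "submodule (add_multiples W I b) R M"
proof -
  interpret I: ideal I R by (rule I)
  note Ws = submoduleE[OF W]
  have Wc: "w \<in> W \<Longrightarrow> w \<in> carrier M" for w using Ws(1) by blast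
  note Ic = I.Icarr
  show ?thesis
  proof (rule submoduleI)
    show "add_multiples W I b \<subseteq> carrier M"
      using Wc Ic b by (auto simp: add_multiples_def)
    show "\<zero>\<^bsub>M\<^esub> \<in> add_multiples W I b"
      unfolding add_multiples_def mem_Collect_eq
      by (rule exI[of _ "\<zero>\<^bsub>M\<^esub>"], rule exI[of _ \<zero>]) (use b submodule_zero[OF W] in simp)
  next
    fix x assume "x \<in> add_multiples W I b"
    then obtain w c where x: "x = w \<oplus>\<^bsub>M\<^esub> c \<odot>\<^bsub>M\<^esub> b" "w \<in> W" "c \<in> I"
      by (auto simp: add_multiples_def)
    have "\<ominus>\<^bsub>M\<^esub> x = \<ominus>\<^bsub>M\<^esub> w \<oplus>\<^bsub>M\<^esub> (\<ominus> c) \<odot>\<^bsub>M\<^esub> b"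
      using x b Wc Ic by (simp add: smult_l_minus M.minus_add)
    then show "\<ominus>\<^bsub>M\<^esub> x \<in> add_multiples W I b"
      using x Ws(3) by (simp add: add_multiplesI)
    fix a assume a: "a \<in> carrier R"
    have "a \<odot>\<^bsub>M\<^esub> x = a \<odot>\<^bsub>M\<^esub> w \<oplus>\<^bsub>M\<^esub> (a \<otimes> c) \<odot>\<^bsub>M\<^esub> b"
      using x b Wc Ic a by (simp add: smult_r_distr smult_assoc1)
    then show "a \<odot>\<^bsub>M\<^esub> x \<in> add_multiples W I b"
      using x a Ws(4) I.I_l_closed by (simp add: add_multiplesI)
  next
    fix x y assume "x \<in> add_multiples W I b" "y \<in> add_multiples W I b"
    then obtain w c v d where x: "x = w \<oplus>\<^bsub>M\<^esub> c \<odot>\<^bsub>M\<^esub> b" "w \<in> W" "c \<in> I"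
      and y: "y = v \<oplus>\<^bsub>M\<^esub> d \<odot>\<^bsub>M\<^esub> b" "v \<in> W" "d \<in> I"
      by (auto simp: add_multiples_def)
    have "x \<oplus>\<^bsub>M\<^esub> y = (w \<oplus>\<^bsub>M\<^esub> v) \<oplus>\<^bsub>M\<^esub> (c \<oplus> d) \<odot>\<^bsub>M\<^esub> b"
      using x y b Wc Ic by (simp add: smult_l_distr M.a_ac)
    then show "x \<oplus>\<^bsub>M\<^esub> y \<in> add_multiples W I b"
      using x y Ws(5) I.a_closed by (simp add: add_multiplesI)
  qed
qed

lemma subset_add_multiples:
  assumes W: "submodule W R M" and I: "ideal I R" and b: "b \<in> carrier M"
  shows "W \<subseteq> add_multiples W I b"
proof
  fix w assume "w \<in> W"
  moreover have "w = w \<oplus>\<^bsub>M\<^esub> \<zero> \<odot>\<^bsub>M\<^esub> b" using b submoduleE(1)[OF W] \<open>w \<in> W\<close> by auto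
  moreover have "\<zero> \<in> I" using I by (simp add: additive_subgroup.zero_closed ideal_def)
  ultimately show "w \<in> add_multiples W I b" unfolding add_multiples_def by blast
qed

text \<open>Isolates the coefficient of one generator, the quantity on which both the leading
  coefficient argument and the exchange argument operate.\<close>

lemma submodule_gen_insert:
  assumes S: "S \<subseteq> carrier M" and b: "b \<in> carrier M"
  shows "submodule_gen R M (insert b S) = add_multiples (submodule_gen R M S) (carrier R) b"
    (is "?L = add_multiples ?W _ b")
proof
  have W: "submodule ?W R M" by (rule submodule_gen_submodule[OF S])
  have L: "submodule ?L R M" using S b by (simp add: submodule_gen_submodule)
  have "b = \<zero>\<^bsub>M\<^esub> \<oplus>\<^bsub>M\<^esub> \<one> \<odot>\<^bsub>M\<^esub> b" using b by simp
  then have "b \<in> add_multiples ?W (carrier R) b"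
    unfolding add_multiples_def using submodule_zero[OF W] by blast
  then show "?L \<subseteq> add_multiples ?W (carrier R) b"
    using subset_add_multiples[OF W R.oneideal b] submodule_gen_superset[of S]
    by (intro submodule_gen_minimal add_multiples_submodule W R.oneideal b) auto
  have "b \<in> ?L" "?W \<subseteq> ?L" using submodule_gen_superset[of "insert b S"]
    by (auto intro: submodule_gen_mono[THEN subsetD, rotated])
  then show "add_multiples ?W (carrier R) b \<subseteq> ?L"
    using submoduleE(4,5)[OF L] by (auto simp: add_multiples_def)
qed

text \<open>Hilbert's argument: the ideal of leading coefficients (those of the last generator \<open>a\<close>) of
  elements of \<open>H\<close> is finitely generated.\<close>

lemma fin_gen_submodule_aux:
  assumes R: "noetherian_ring R"
    and A: "finite A" "A \<subseteq> carrier M"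
  shows "submodule H R M \<Longrightarrow> H \<subseteq> submodule_gen R M A \<Longrightarrow> fin_gen R M H"
  using A
proof (induction A arbitrary: H rule: finite_induct)
  case empty
  have "submodule {\<zero>\<^bsub>M\<^esub>} R M" by (rule submoduleI) auto
  then have "submodule_gen R M {} \<subseteq> {\<zero>\<^bsub>M\<^esub>}" by (rule submodule_gen_minimal[rotated]) simp
  then have "H = submodule_gen R M {}"
    using empty.prems submodule_gen_minimal[of "{}" H] submodule_zero[of H] by auto
  then show ?case unfolding fin_gen_def by blast
next
  case (insert a A)
  define W where "W = submodule_gen R M A"
  have a: "a \<in> carrier M" and A: "A \<subseteq> carrier M" using insert.prems by auto
  have W: "submodule W R M" using A by (simp add: W_def submodule_gen_submodule)
  note H = insert.prems(1)
  have Hc: "x \<in> H \<Longrightarrow> x \<in> carrier M" for x using submoduleE(1)[OF H] by blast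
  have Wc: "x \<in> W \<Longrightarrow> x \<in> carrier M" for x using submoduleE(1)[OF W] by blast
  have HW: "H \<subseteq> add_multiples W (carrier R) a"
    using insert.prems submodule_gen_insert[OF A a] by (simp add: W_def)
  \<comment> \<open>Stated for an arbitrary submodule \<open>K\<close>, since it is applied both to
    \<open>H\<close> and to the candidate span that is to exhaust \<open>H\<close>.\<close>
  have ideal: "ideal {r \<in> carrier R. \<exists>w\<in>W. w \<oplus>\<^bsub>M\<^esub> r \<odot>\<^bsub>M\<^esub> a \<in> K} R"
    if K: "submodule K R M" for K
  proof (rule idealI[OF R.ring_axioms])
    let ?J = "{r \<in> carrier R. \<exists>w\<in>W. w \<oplus>\<^bsub>M\<^esub> r \<odot>\<^bsub>M\<^esub> a \<in> K}"
    have mult: "x \<otimes> r \<in> ?J" if r: "r \<in> ?J" and x: "x \<in> carrier R" for r x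
    proof -
      from r obtain w where w: "w \<in> W" "w \<oplus>\<^bsub>M\<^esub> r \<odot>\<^bsub>M\<^esub> a \<in> K" "r \<in> carrier R" by auto
      have "x \<odot>\<^bsub>M\<^esub> w \<oplus>\<^bsub>M\<^esub> (x \<otimes> r) \<odot>\<^bsub>M\<^esub> a = x \<odot>\<^bsub>M\<^esub> (w \<oplus>\<^bsub>M\<^esub> r \<odot>\<^bsub>M\<^esub> a)"
        using w x a Wc by (simp add: smult_r_distr smult_assoc1)
      also have "\<dots> \<in> K" using submoduleE(4)[OF K] w x by simp
      finally show ?thesis using submoduleE(4)[OF W] w x by auto
    qed
    then show "x \<otimes> r \<in> ?J" "r \<otimes> x \<in> ?J" if "r \<in> ?J" "x \<in> carrier R" for r x
      using that by (auto simp: R.m_comm[of r x])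
    show "subgroup ?J (add_monoid R)"
    proof (rule R.add.subgroupI)
      show "?J \<subseteq> carrier R" by auto
      have "\<zero>\<^bsub>M\<^esub> \<oplus>\<^bsub>M\<^esub> \<zero> \<odot>\<^bsub>M\<^esub> a \<in> K" using a submodule_zero[OF K] by simp
      then show "?J \<noteq> {}" using submodule_zero[OF W] by auto
    next
      fix r assume r: "r \<in> ?J"
      then have "\<ominus> r = (\<ominus> \<one>) \<otimes> r" by (simp add: R.l_minus)
      then show "\<ominus> r \<in> ?J" using mult[OF r, of "\<ominus> \<one>"] by simp
    next
      fix r s assume "r \<in> ?J" "s \<in> ?J"
      then obtain v w where r: "r \<in> carrier R" "v \<in> W" "v \<oplus>\<^bsub>M\<^esub> r \<odot>\<^bsub>M\<^esub> a \<in> K"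
        and s: "s \<in> carrier R" "w \<in> W" "w \<oplus>\<^bsub>M\<^esub> s \<odot>\<^bsub>M\<^esub> a \<in> K" by auto
      have "(v \<oplus>\<^bsub>M\<^esub> w) \<oplus>\<^bsub>M\<^esub> (r \<oplus> s) \<odot>\<^bsub>M\<^esub> a = (v \<oplus>\<^bsub>M\<^esub> r \<odot>\<^bsub>M\<^esub> a) \<oplus>\<^bsub>M\<^esub> (w \<oplus>\<^bsub>M\<^esub> s \<odot>\<^bsub>M\<^esub> a)"
        using r s a Wc by (simp add: smult_l_distr M.a_ac)
      also have "\<dots> \<in> K" using submoduleE(5)[OF K] r s by simp
      finally show "r \<oplus> s \<in> ?J" using submoduleE(5)[OF W] r s by auto
    qed
  qed
  define I where "I = {r \<in> carrier R. \<exists>w\<in>W. w \<oplus>\<^bsub>M\<^esub> r \<odot>\<^bsub>M\<^esub> a \<in> H}"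
  obtain C where C: "C \<subseteq> carrier R" "finite C" "I = Idl C"
    using noetherian_ring.finetely_gen[OF R] ideal[OF H] unfolding I_def by meson
  have "\<forall>c\<in>C. \<exists>w\<in>W. w \<oplus>\<^bsub>M\<^esub> c \<odot>\<^bsub>M\<^esub> a \<in> H"
    using R.genideal_self[OF C(1)] C(3) by (auto simp: I_def)
  then obtain w where w: "\<And>c. c \<in> C \<Longrightarrow> w c \<in> W \<and> w c \<oplus>\<^bsub>M\<^esub> c \<odot>\<^bsub>M\<^esub> a \<in> H"
    by metis
  \<comment> \<open>Elements of \<open>H\<close> with leading coefficient zero:
    \<open>H \<inter> W\<close> lies in the span of \<open>A\<close>, so the induction hypothesis
    applies.\<close>
  obtain B where B: "B \<subseteq> H \<inter> W" "finite B" "submodule_gen R M B = H \<inter> W"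
    using insert.IH[of "H \<inter> W"] submodule_Int[OF H W] A by (auto simp: fin_gen_def W_def)
  \<comment> \<open>Generators of \<open>H \<inter> W\<close>, together with one element of
    \<open>H\<close> for each generator of the ideal of leading coefficients.\<close>
  define D where "D = B \<union> (\<lambda>c. w c \<oplus>\<^bsub>M\<^esub> c \<odot>\<^bsub>M\<^esub> a) ` C"
  define K where "K = submodule_gen R M D"
  have DH: "D \<subseteq> H" using B w by (auto simp: D_def)
  have K: "submodule K R M" using DH Hc by (auto simp: K_def intro!: submodule_gen_submodule)
  have DK: "D \<subseteq> K" unfolding K_def by (rule submodule_gen_superset)
  have HWK: "H \<inter> W \<subseteq> K"
    using B(3) submodule_gen_mono[of B D] by (auto simp: K_def D_def)
  \<comment> \<open>The leading coefficients of elements of \<open>K\<close> form an ideal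
    containing \<open>C\<close>, so every leading coefficient of \<open>H\<close> is also attained
    in \<open>K\<close>.\<close>
  have "Idl C \<subseteq> {r \<in> carrier R. \<exists>w\<in>W. w \<oplus>\<^bsub>M\<^esub> r \<odot>\<^bsub>M\<^esub> a \<in> K}"
    using C(1) w DK by (intro R.genideal_minimal ideal K) (force simp: D_def)
  note IK = this[folded C(3)]
  have "H \<subseteq> K"
  proof
    fix h assume h: "h \<in> H"
    then obtain v r where v: "h = v \<oplus>\<^bsub>M\<^esub> r \<odot>\<^bsub>M\<^esub> a" "v \<in> W" "r \<in> carrier R"
      using HW by (auto simp: add_multiples_def)
    then have "r \<in> I" using h by (auto simp: I_def)
    then obtain u where u: "u \<in> W" "u \<oplus>\<^bsub>M\<^esub> r \<odot>\<^bsub>M\<^esub> a \<in> K" using IK by auto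
    \<comment> \<open>\<open>?k\<close> has the same leading coefficient \<open>r\<close> as
      \<open>h\<close>, so the difference has no \<open>a\<close>-part left and falls into
      \<open>H \<inter> W\<close>, which \<open>K\<close> contains.\<close>
    let ?k = "u \<oplus>\<^bsub>M\<^esub> r \<odot>\<^bsub>M\<^esub> a"
    have kH: "?k \<in> H" using u submodule_gen_minimal[OF DH H] by (auto simp: K_def)
    have "h \<ominus>\<^bsub>M\<^esub> ?k = v \<ominus>\<^bsub>M\<^esub> u"
      using u v a Wc by (simp add: a_minus_def M.minus_add M.a_ac M.r_neg M.r_neg1 M.r_neg2)
    then have "h \<ominus>\<^bsub>M\<^esub> ?k \<in> H \<inter> W"
      using submodule_minus[OF H h kH] submodule_minus[OF W v(2) u(1)] by simp
    then have "(h \<ominus>\<^bsub>M\<^esub> ?k) \<oplus>\<^bsub>M\<^esub> ?k \<in> K"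
      using HWK u submoduleE(5)[OF K] by blast
    then show "h \<in> K" using Hc[OF h] Hc[OF kH] by (simp add: a_minus_def M.a_assoc M.l_neg)
  qed
  then have "submodule_gen R M D = H"
    using submodule_gen_minimal[OF DH H] by (auto simp: K_def)
  moreover have "finite D" using B C by (simp add: D_def)
  ultimately show ?case using DH unfolding fin_gen_def by blast
qed

lemma fin_gen_submodule:
  assumes "noetherian_ring R" "fin_gen R M (carrier M)" "submodule H R M"
  shows "fin_gen R M H"
proof -
  obtain A where A: "A \<subseteq> carrier M" "finite A" "submodule_gen R M A = carrier M"
    using assms(2) unfolding fin_gen_def by blast
  show ?thesis
    by (rule fin_gen_submodule_aux[OF assms(1) A(2,1) assms(3)]) (simp add: A(3) submoduleE(1)[OF assms(3)])
qed

text \<open>An element \<open>b\<close> of \<open>B\<close> outside \<open>A\<close> and not in the span \<open>W\<close> of the others can be traded for an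
  element of \<open>A\<close> whose \<open>b\<close>-coefficient is a unit: were \<open>A\<close> contained in \<open>W + \<mm> b\<close>, then \<open>b\<close> would be
  in \<open>W + \<mm> b\<close>, hence in \<open>W\<close>.\<close>

lemma local_exchange:
  assumes R: "noetherian_ring R" and L: "local_ring R \<mm>"
    and A: "A \<subseteq> carrier M" and B: "finite B" "B \<subseteq> carrier M"
    and AB: "submodule_gen R M A = submodule_gen R M B"
  shows "\<exists>A'\<subseteq>A. finite A' \<and> card A' \<le> card B \<and> submodule_gen R M A' = submodule_gen R M A"
  using B AB
\<comment> \<open>The measure counts the elements of \<open>B\<close> still outside
  \<open>A\<close>; at zero, \<open>B\<close> itself is the required subset.\<close>
proof (induction "card (B - A)" arbitrary: B rule: less_induct)
  case less
  show ?case
  proof (cases "B \<subseteq> A")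
    case True
    then show ?thesis using less.prems by (intro exI[of _ B]) auto
  next
    case False
    then obtain b where b: "b \<in> B" "b \<notin> A" by blast
    define S where "S = B - {b}"
    define W where "W = submodule_gen R M S"
    have S: "finite S" "S \<subseteq> carrier M" "b \<notin> S" "B = insert b S"
      using less.prems b by (auto simp: S_def)
    have cardB: "card B = Suc (card S)"
      unfolding S_def by (rule card.remove[OF less.prems(1) b(1)])
    have bc: "b \<in> carrier M" using b less.prems by auto
    have W: "submodule W R M" using S by (simp add: W_def submodule_gen_submodule)
    have Wc: "w \<in> W \<Longrightarrow> w \<in> carrier M" for w using submoduleE(1)[OF W] by blast
    \<comment> \<open>Any new set built from \<open>S\<close> and elements of \<open>A\<close> has
      lost \<open>b\<close> outside \<open>A\<close> and gained nothing there.\<close>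
    have small: "card (T - A) < card (B - A)" if "T \<subseteq> S \<union> A" for T
      using that b less.prems(1) by (intro psubset_card_mono) (auto simp: S_def)
    have gB: "submodule_gen R M B = add_multiples W (carrier R) b"
      using submodule_gen_insert[OF S(2) bc] by (simp add: S(4) W_def)
    interpret m: maximalideal \<mm> R using L by (simp add: local_ring_def)
    show ?thesis
    proof (cases "b \<in> W")
      case True
      \<comment> \<open>A redundant \<open>b\<close> is dropped, with no replacement from
        \<open>A\<close>.\<close>
      have "B \<subseteq> W" using True S(4) submodule_gen_superset[of S] by (auto simp: W_def)
      then have "submodule_gen R M B = submodule_gen R M S"
        using submodule_gen_minimal[OF _ W, of B] submodule_gen_mono[of S B] S(4) by (auto simp: W_def)
      then show ?thesis
        using less.hyps[of S] small[of S] S(1,2) cardB less.prems(3)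
        by (metis le_SucI sup_ge1)
    next
      case bW: False
      have "\<not> A \<subseteq> add_multiples W \<mm> b"
      proof
        assume "A \<subseteq> add_multiples W \<mm> b"
        then have "submodule_gen R M A \<subseteq> add_multiples W \<mm> b"
          by (intro submodule_gen_minimal add_multiples_submodule W bc m.ideal_axioms)
        then have "b \<in> add_multiples W \<mm> b"
          using less.prems(3) submodule_gen_superset[of B] b by auto
        then obtain w c where c: "b = w \<oplus>\<^bsub>M\<^esub> c \<odot>\<^bsub>M\<^esub> b" "w \<in> W" "c \<in> \<mm>"
          by (auto simp: add_multiples_def)
        have cR: "c \<in> carrier R" using c(3) m.Icarr by blast
        \<comment> \<open>The argument of Nakayama's lemma: \<open>(1 - c) b = w\<close>, and
          \<open>1 - c\<close> is a unit because \<open>c \<in> \<mm>\<close>, so \<open>b\<close>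
          would lie in \<open>W\<close>.\<close>
        have "\<one> \<ominus> c \<notin> \<mm>"
        proof
          assume "\<one> \<ominus> c \<in> \<mm>"
          then have "(\<one> \<ominus> c) \<oplus> c \<in> \<mm>" using c(3) by (intro m.a_closed)
          then have "\<one> \<in> \<mm>" using cR by (simp add: a_minus_def R.a_assoc R.l_neg)
          then show False using m.one_imp_carrier m.I_notcarr by blast
        qed
        then have u: "\<one> \<ominus> c \<in> Units R"
          using noetherian_ring.local_ring_UnitsI[OF R L] cR by simp
        have "(\<one> \<ominus> c) \<odot>\<^bsub>M\<^esub> b = b \<ominus>\<^bsub>M\<^esub> c \<odot>\<^bsub>M\<^esub> b"
          using bc cR by (simp add: a_minus_def smult_l_distr smult_l_minus)
        also have "\<dots> = (w \<oplus>\<^bsub>M\<^esub> c \<odot>\<^bsub>M\<^esub> b) \<ominus>\<^bsub>M\<^esub> c \<odot>\<^bsub>M\<^esub> b"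
          using arg_cong[OF c(1), of "\<lambda>x. x \<ominus>\<^bsub>M\<^esub> c \<odot>\<^bsub>M\<^esub> b"] .
        also have "\<dots> = w"
          using cR bc Wc[OF c(2)] by (simp add: a_minus_def M.a_assoc M.r_neg)
        finally have w: "(\<one> \<ominus> c) \<odot>\<^bsub>M\<^esub> b = w" .
        have "inv (\<one> \<ominus> c) \<odot>\<^bsub>M\<^esub> w = b"
          using u bc cR by (simp add: w[symmetric] smult_assoc1[symmetric])
        moreover have "inv (\<one> \<ominus> c) \<odot>\<^bsub>M\<^esub> w \<in> W"
          using submoduleE(4)[OF W] c(2) u by simp
        ultimately show False using bW by simp
      qed
      then obtain a where a: "a \<in> A" "a \<notin> add_multiples W \<mm> b" by blast
      then have "a \<in> add_multiples W (carrier R) b"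
        using gB less.prems(3) submodule_gen_superset[of A] by auto
      then obtain w c where c: "a = w \<oplus>\<^bsub>M\<^esub> c \<odot>\<^bsub>M\<^esub> b" "w \<in> W" "c \<in> carrier R"
        by (auto simp: add_multiples_def)
      \<comment> \<open>Otherwise this expression for \<open>a\<close> would exhibit it as an
        element of \<open>add_multiples W \<mm> b\<close>. Being a unit, \<open>c\<close> allows
        solving for \<open>b\<close>.\<close>
      then have "c \<notin> \<mm>" using a by (auto simp: add_multiples_def)
      then have u: "c \<in> Units R" using noetherian_ring.local_ring_UnitsI[OF R L] c by simp
      let ?B = "insert a S"
      have ac: "a \<in> carrier M" using a A by blast
      have sub: "?B \<subseteq> carrier M" using ac S by auto
      have gen: "submodule (submodule_gen R M ?B) R M" by (rule submodule_gen_submodule[OF sub])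
      have WB: "W \<subseteq> submodule_gen R M ?B" unfolding W_def by (rule submodule_gen_mono) auto
      have aB: "a \<in> submodule_gen R M ?B" using submodule_gen_superset[of ?B] by simp
      have "b = inv c \<odot>\<^bsub>M\<^esub> (c \<odot>\<^bsub>M\<^esub> b)" using u c(3) bc by (simp add: smult_assoc1[symmetric])
      also have "c \<odot>\<^bsub>M\<^esub> b = a \<ominus>\<^bsub>M\<^esub> w"
        using c Wc bc by (simp add: a_minus_def M.a_ac M.r_neg M.r_neg1 M.r_neg2)
      also have "inv c \<odot>\<^bsub>M\<^esub> (a \<ominus>\<^bsub>M\<^esub> w) \<in> submodule_gen R M ?B"
        using WB c(2) u by (intro submoduleE(4)[OF gen] submodule_minus[OF gen aB]) auto
      finally have "b \<in> submodule_gen R M ?B" .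
      then have "submodule_gen R M B \<subseteq> submodule_gen R M ?B"
        using submodule_gen_superset[of ?B] S(4) by (intro submodule_gen_minimal gen) auto
      moreover have "submodule_gen R M ?B \<subseteq> submodule_gen R M B"
      proof (rule submodule_gen_minimal)
        show "submodule (submodule_gen R M B) R M"
          by (rule submodule_gen_submodule) (rule less.prems)
        show "?B \<subseteq> submodule_gen R M B"
          using a less.prems(3) submodule_gen_superset[of A] submodule_gen_superset[of B] S(4) by auto
      qed
      ultimately have "submodule_gen R M A = submodule_gen R M ?B" using less.prems(3) by simp
      moreover have "card ?B \<le> card B" using S(1) cardB by (simp add: card_insert_if)
      moreover have "card (?B - A) < card (B - A)" using a by (intro small) auto
      ultimately show ?thesis using less.hyps[of ?B] S(1) sub by (meson finite_insert order_trans)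
    qed
  qed
qed

section \<open>The minimal number of generators as an attained minimum\<close>

lemma min_num_gens_le:
  assumes "A \<subseteq> N" "finite A" "submodule_gen R M A = N"
  shows "min_num_gens R M N \<le> card A"
  unfolding min_num_gens_def by (rule Least_le) (use assms in blast)

lemma min_num_gens_obtain:
  assumes "fin_gen R M N"
  obtains A where "A \<subseteq> N" "finite A" "card A = min_num_gens R M N" "submodule_gen R M A = N"
proof -
  let ?P = "\<lambda>n. \<exists>A. A \<subseteq> N \<and> finite A \<and> card A = n \<and> submodule_gen R M A = N"
  have "\<exists>n. ?P n" using assms by (auto simp: fin_gen_def)
  then have "?P (LEAST n. ?P n)" by (rule LeastI_ex)
  then show thesis using that by (auto simp: min_num_gens_def)
qed

end

section \<open>Base change\<close>

text \<open>Reduces the descent of a map to a base change to a check on the defining relations. It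
  serves for the scalar action and for the change of rings.\<close>

lemma frag_extend_generate:
  assumes c: "c \<in> generate (free_Abelian_group U) A"
    and A: "A \<subseteq> carrier (free_Abelian_group U)"
    and B: "B \<subseteq> carrier (free_Abelian_group V)"
    and f: "\<And>r. r \<in> A \<Longrightarrow> frag_extend f r \<in> generate (free_Abelian_group V) B"
  shows "frag_extend f c \<in> generate (free_Abelian_group V) B"
proof -
  interpret V: group "free_Abelian_group V" by simp
  have sub: "subgroup (generate (free_Abelian_group V) B) (free_Abelian_group V)"
    by (rule V.generate_is_subgroup[OF B])
  from c show ?thesis
  proof (induction c rule: generate.induct)
    case one
    then show ?case using subgroup.one_closed[OF sub] by simp
  next
    case (incl h)
    then show ?case by (rule f)
  next
    case (inv h)
    \<comment> \<open>Inverses in a free abelian group are negatives only for elements of the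
      carrier, so the supports of \<open>h\<close> and of its image must be known.\<close>
    have "Poly_Mapping.keys h \<subseteq> U"
      using subsetD[OF A inv] by simp
    moreover have "Poly_Mapping.keys (frag_extend f h) \<subseteq> V"
      using subsetD[OF subgroup.subset[OF sub] f[OF inv]] by simp
    ultimately show ?case
      using subgroup.m_inv_closed[OF sub f[OF inv]] by (simp add: frag_extend_minus)
  next
    case (eng g h)
    then show ?case using subgroup.m_closed[OF sub eng.IH] by (simp add: frag_extend_add)
  qed
qed

section \<open>The module structure on a base change\<close>

locale base_change_data = M: module R M + S: cring S
  for R :: "('a, 'b) ring_scheme" (structure) and M :: "('a, 'm, 'c) module_scheme" (structure)
    and S :: "('s, 't) ring_scheme" (structure) +
  fixes \<phi> :: "'a \<Rightarrow> 's"
  assumes \<phi>_closed: "r \<in> carrier R \<Longrightarrow> \<phi> r \<in> carrier S"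
begin

abbreviation "G \<equiv> base_change_free S M"
abbreviation "K \<equiv> base_change_null R S \<phi> M"
abbreviation "BC \<equiv> base_change R S \<phi> M"
abbreviation "\<pi> c \<equiv> K #>\<^bsub>G\<^esub> c"

sublocale G: comm_group "base_change_free S M"
  unfolding base_change_free_def by (rule abelian_free_Abelian_group)

lemma carrier_G: "c \<in> carrier G \<longleftrightarrow> Poly_Mapping.keys c \<subseteq> carrier S \<times> carrier M"
  by (simp add: base_change_free_def)

lemma G_ops [simp]:
  "x \<otimes>\<^bsub>G\<^esub> y = x + y" "\<one>\<^bsub>G\<^esub> = 0" "x \<in> carrier G \<Longrightarrow> inv\<^bsub>G\<^esub> x = - x"
  by (auto simp: base_change_free_def)

lemma frag_of_G [simp]: "frag_of (s, x) \<in> carrier G \<longleftrightarrow> s \<in> carrier S \<and> x \<in> carrier M"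
  by (simp add: carrier_G)

lemma G_add [simp]: "x \<in> carrier G \<Longrightarrow> y \<in> carrier G \<Longrightarrow> x + y \<in> carrier G"
  using G.m_closed[of x y] by simp

lemma G_minus [simp]: "x \<in> carrier G \<Longrightarrow> - x \<in> carrier G"
  using G.inv_closed[of x] by simp

lemma G_diff [simp]: "x \<in> carrier G \<Longrightarrow> y \<in> carrier G \<Longrightarrow> x - y \<in> carrier G"
  using G_add[of x "- y"] by simp

text \<open>Differences cover sums and negatives at once, so each later induction has a single
  composite case.\<close>

lemma G_induct [consumes 1, case_names zero diff of]:
  assumes "c \<in> carrier G" "P 0"
    "\<And>x y. x \<in> carrier G \<Longrightarrow> y \<in> carrier G \<Longrightarrow> P x \<Longrightarrow> P y \<Longrightarrow> P (x - y)"
    "\<And>s x. s \<in> carrier S \<Longrightarrow> x \<in> carrier M \<Longrightarrow> P (frag_of (s, x))"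
  shows "P c"
  using assms free_Abelian_group_induct[of c "carrier S \<times> carrier M" P] by (auto simp: carrier_G)

lemma rels_subset: "base_change_rels R S \<phi> M \<subseteq> carrier G"
  by (auto simp: base_change_rels_def \<phi>_closed)

lemma K_subgroup: "subgroup K G"
  unfolding base_change_null_def by (rule G.generate_is_subgroup[OF rels_subset])

lemma K_normal: "K \<lhd> G"
  by (rule G.subgroup_imp_normal[OF K_subgroup])

lemma K_carrier: "k \<in> K \<Longrightarrow> k \<in> carrier G"
  using subgroup.subset[OF K_subgroup] by blast

lemma K_closed:
  "0 \<in> K" "x \<in> K \<Longrightarrow> y \<in> K \<Longrightarrow> x + y \<in> K" "x \<in> K \<Longrightarrow> - x \<in> K"
  using subgroup.one_closed[OF K_subgroup] subgroup.m_closed[OF K_subgroup, of x y]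
    subgroup.m_inv_closed[OF K_subgroup, of x] K_carrier[of x] by auto

lemma K_diff: "x \<in> K \<Longrightarrow> y \<in> K \<Longrightarrow> x - y \<in> K"
  using K_closed(2)[of x "- y"] K_closed(3)[of y] by simp

lemma rels_K: "r \<in> base_change_rels R S \<phi> M \<Longrightarrow> r \<in> K"
  unfolding base_change_null_def by (rule generate.incl)

lemma \<pi>_eq_iff:
  assumes "x \<in> carrier G" "y \<in> carrier G"
  shows "\<pi> x = \<pi> y \<longleftrightarrow> x - y \<in> K"
proof
  assume "\<pi> x = \<pi> y"
  then have "x \<in> \<pi> y" using G.rcos_self[OF assms(1) K_subgroup] by simp
  then show "x - y \<in> K" by (auto simp: r_coset_def)
next
  assume "x - y \<in> K"
  then have "x \<in> \<pi> y" by (force simp: r_coset_def)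
  then show "\<pi> x = \<pi> y" using G.repr_independence[OF _ assms(2) K_subgroup] by simp
qed

lemma carrier_BC: "carrier BC = \<pi> ` carrier G"
  by (auto simp: base_change_def Let_def carrier_FactGroup)

lemma \<pi>_closed [simp]: "c \<in> carrier G \<Longrightarrow> \<pi> c \<in> carrier BC"
  by (simp add: carrier_BC)

lemma BC_zero: "\<zero>\<^bsub>BC\<^esub> = \<pi> 0"
proof -
  have "\<pi> 0 = K" using G.coset_join2[OF _ K_subgroup K_closed(1)] K_carrier[OF K_closed(1)] by simp
  then show ?thesis by (simp add: base_change_def Let_def FactGroup_def)
qed

lemma BC_add:
  assumes "x \<in> carrier G" "y \<in> carrier G"
  shows "\<pi> x \<oplus>\<^bsub>BC\<^esub> \<pi> y = \<pi> (x + y)"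
  using normal.rcos_sum[OF K_normal assms] by (simp add: base_change_def Let_def FactGroup_def)

lemma act_of [simp]: "base_change_act S s (frag_of (t, x)) = frag_of (s \<otimes>\<^bsub>S\<^esub> t, x)"
  by (simp add: base_change_act_def)

lemma act_zero [simp]: "base_change_act S s 0 = 0"
  by (simp add: base_change_act_def)

lemma act_add: "base_change_act S s (x + y) = base_change_act S s x + base_change_act S s y"
  by (simp add: base_change_act_def frag_extend_add)

lemma act_diff: "base_change_act S s (x - y) = base_change_act S s x - base_change_act S s y"
  by (simp add: base_change_act_def frag_extend_diff)

lemma act_closed [simp]:
  assumes "s \<in> carrier S" "c \<in> carrier G"
  shows "base_change_act S s c \<in> carrier G"
  using assms(2)
proof (induction c rule: G_induct)
  case zero then show ?case using G.one_closed by simp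
qed (use assms(1) in \<open>auto simp: act_diff\<close>)

text \<open>Makes the action descend to cosets: multiplying the left entries by \<open>s\<close>
  turns each relation into one of the same kind.\<close>

lemma act_K:
  assumes s: "s \<in> carrier S" and k: "k \<in> K"
  shows "base_change_act S s k \<in> K"
  unfolding base_change_null_def base_change_free_def base_change_act_def
proof (rule frag_extend_generate)
  show "k \<in> generate (free_Abelian_group (carrier S \<times> carrier M)) (base_change_rels R S \<phi> M)"
    using k by (simp add: base_change_null_def base_change_free_def)
  fix r assume "r \<in> base_change_rels R S \<phi> M"
  then have "base_change_act S s r \<in> base_change_rels R S \<phi> M"
  proof (unfold base_change_rels_def, elim UnE CollectE exE conjE, goal_cases)
    case (1 t u x)
    then show ?case using s
      by (intro UnI1 CollectI exI[of _ "s \<otimes>\<^bsub>S\<^esub> t"] exI[of _ "s \<otimes>\<^bsub>S\<^esub> u"] exI[of _ x])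
        (simp add: act_diff act_add S.r_distr)
  next
    case (2 t x y)
    then show ?case using s
      by (intro UnI1[OF UnI2] CollectI exI[of _ "s \<otimes>\<^bsub>S\<^esub> t"] exI[of _ x] exI[of _ y])
        (simp add: act_diff act_add)
  next
    case (3 t r x)
    then show ?case using s \<phi>_closed
      by (intro UnI2 CollectI exI[of _ "s \<otimes>\<^bsub>S\<^esub> t"] exI[of _ r] exI[of _ x])
        (simp add: act_diff S.m_assoc)
  qed
  then show "frag_extend (\<lambda>(t, x). frag_of (s \<otimes>\<^bsub>S\<^esub> t, x)) r
      \<in> generate (free_Abelian_group (carrier S \<times> carrier M)) (base_change_rels R S \<phi> M)"
    by (auto simp: base_change_act_def intro: generate.incl)
qed (use rels_subset[unfolded base_change_free_def] in simp_all)

text \<open>The action is a union over all representatives of a coset. As the representatives differ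
  by elements of \<open>K\<close> and the action preserves \<open>K\<close>, all members of that
  union coincide.\<close>

lemma BC_smult:
  assumes s: "s \<in> carrier S" and c: "c \<in> carrier G"
  shows "s \<odot>\<^bsub>BC\<^esub> \<pi> c = \<pi> (base_change_act S s c)"
proof -
  have "\<pi> (base_change_act S s d) = \<pi> (base_change_act S s c)" if d: "d \<in> \<pi> c" for d
  proof -
    obtain k where k: "k \<in> K" "d = k + c" using d by (auto simp: r_coset_def)
    then have "d \<in> carrier G" using K_carrier c by simp
    then show ?thesis
      using act_K[OF s k(1)] s c by (subst \<pi>_eq_iff) (auto simp: k act_add K_carrier)
  qed
  then have "(\<Union>d\<in>\<pi> c. \<pi> (base_change_act S s d)) = (\<Union>d\<in>\<pi> c. \<pi> (base_change_act S s c))"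
    by (intro SUP_cong refl)
  also have "\<dots> = \<pi> (base_change_act S s c)"
    using G.rcos_self[OF c K_subgroup] by (intro UN_constant_eq) auto
  finally show ?thesis by (simp add: base_change_def Let_def)
qed

lemma tensor_def: "base_change_tensor R S \<phi> M s x = \<pi> (frag_of (s, x))"
  by (simp add: base_change_tensor_def)

text \<open>The other laws of the scalar action hold already in the free group; this one uses the
  relations of additivity in the left factor.\<close>

lemma act_l_distr:
  assumes "s \<in> carrier S" "t \<in> carrier S" "c \<in> carrier G"
  shows "base_change_act S (s \<oplus>\<^bsub>S\<^esub> t) c - (base_change_act S s c + base_change_act S t c) \<in> K"
  using assms(3)
proof (induction c rule: G_induct)
  case zero
  then show ?case using K_closed by simp
next
  case (diff x y)
  then show ?case using K_diff[OF diff.IH] by (simp add: act_diff algebra_simps)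
next
  case (of u x)
  then show ?case using assms
    by (intro rels_K) (auto simp: base_change_rels_def S.l_distr)
qed

lemma module_BC: "module S BC"
proof (rule moduleI)
  show "cring S" by (rule S.is_cring)
  have zero: "0 \<in> carrier G" by (rule K_carrier[OF K_closed(1)])
  have rep: "\<exists>c\<in>carrier G. u = \<pi> c" if "u \<in> carrier BC" for u
    using that unfolding carrier_BC by blast
  show "abelian_group BC"
  proof (rule abelian_groupI)
    show "\<zero>\<^bsub>BC\<^esub> \<in> carrier BC" using zero by (simp add: BC_zero)
  next
    fix u v assume "u \<in> carrier BC" "v \<in> carrier BC"
    then obtain c d where c: "c \<in> carrier G" "u = \<pi> c" and d: "d \<in> carrier G" "v = \<pi> d"
      using rep by meson
    show "u \<oplus>\<^bsub>BC\<^esub> v \<in> carrier BC" "u \<oplus>\<^bsub>BC\<^esub> v = v \<oplus>\<^bsub>BC\<^esub> u"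
      using c d by (simp_all add: BC_add add.commute)
    fix w assume "w \<in> carrier BC"
    then obtain e where e: "e \<in> carrier G" "w = \<pi> e" using rep by meson
    show "u \<oplus>\<^bsub>BC\<^esub> v \<oplus>\<^bsub>BC\<^esub> w = u \<oplus>\<^bsub>BC\<^esub> (v \<oplus>\<^bsub>BC\<^esub> w)"
      using c d e by (simp add: BC_add add.assoc)
  next
    fix u assume "u \<in> carrier BC"
    then obtain c where c: "c \<in> carrier G" "u = \<pi> c" using rep by meson
    show "\<zero>\<^bsub>BC\<^esub> \<oplus>\<^bsub>BC\<^esub> u = u" using c zero by (simp add: BC_zero BC_add)
    show "\<exists>v\<in>carrier BC. v \<oplus>\<^bsub>BC\<^esub> u = \<zero>\<^bsub>BC\<^esub>"
      using c by (intro bexI[of _ "\<pi> (- c)"]) (simp_all add: BC_zero BC_add)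
  qed
next
  fix s u assume s: "s \<in> carrier S" and "u \<in> carrier BC"
  then obtain c where c: "u = \<pi> c" "c \<in> carrier G" by (auto simp: carrier_BC)
  show "s \<odot>\<^bsub>BC\<^esub> u \<in> carrier BC" using s c by (simp add: BC_smult)
  fix t assume t: "t \<in> carrier S"
  show "(s \<oplus>\<^bsub>S\<^esub> t) \<odot>\<^bsub>BC\<^esub> u = s \<odot>\<^bsub>BC\<^esub> u \<oplus>\<^bsub>BC\<^esub> t \<odot>\<^bsub>BC\<^esub> u"
    using s t c act_l_distr[OF s t c(2)] by (simp add: BC_smult BC_add \<pi>_eq_iff)
  have "base_change_act S (s \<otimes>\<^bsub>S\<^esub> t) c = base_change_act S s (base_change_act S t c)"
    using c(2) by (induction c rule: G_induct) (use s t in \<open>auto simp: act_diff S.m_assoc\<close>)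
  then show "(s \<otimes>\<^bsub>S\<^esub> t) \<odot>\<^bsub>BC\<^esub> u = s \<odot>\<^bsub>BC\<^esub> (t \<odot>\<^bsub>BC\<^esub> u)"
    using s t c by (simp add: BC_smult)
next
  fix s u v assume s: "s \<in> carrier S" and "u \<in> carrier BC" "v \<in> carrier BC"
  then obtain c d where c: "u = \<pi> c" "c \<in> carrier G" "v = \<pi> d" "d \<in> carrier G"
    by (auto simp: carrier_BC)
  then show "s \<odot>\<^bsub>BC\<^esub> (u \<oplus>\<^bsub>BC\<^esub> v) = s \<odot>\<^bsub>BC\<^esub> u \<oplus>\<^bsub>BC\<^esub> s \<odot>\<^bsub>BC\<^esub> v"
    using s by (simp add: BC_smult BC_add act_add)
next
  fix u assume "u \<in> carrier BC"
  then obtain c where c: "u = \<pi> c" "c \<in> carrier G" by (auto simp: carrier_BC)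
  have "base_change_act S \<one>\<^bsub>S\<^esub> c = c"
    using c(2) by (induction c rule: G_induct) (auto simp: act_diff)
  then show "\<one>\<^bsub>S\<^esub> \<odot>\<^bsub>BC\<^esub> u = u" using c by (simp add: BC_smult)
qed

section \<open>Calculation with elementary tensors\<close>

lemma tensor_closed [simp]:
  "s \<in> carrier S \<Longrightarrow> x \<in> carrier M \<Longrightarrow> base_change_tensor R S \<phi> M s x \<in> carrier BC"
  by (simp add: tensor_def)

lemma tensor_add:
  assumes "s \<in> carrier S" "x \<in> carrier M" "y \<in> carrier M"
  shows "base_change_tensor R S \<phi> M s (x \<oplus>\<^bsub>M\<^esub> y)
       = base_change_tensor R S \<phi> M s x \<oplus>\<^bsub>BC\<^esub> base_change_tensor R S \<phi> M s y"
proof -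
  have "frag_of (s, x \<oplus>\<^bsub>M\<^esub> y) - (frag_of (s, x) + frag_of (s, y)) \<in> K"
    using assms by (intro rels_K) (auto simp: base_change_rels_def)
  then show ?thesis using assms by (simp add: tensor_def BC_add \<pi>_eq_iff)
qed

lemma tensor_smult:
  assumes "s \<in> carrier S" "t \<in> carrier S" "x \<in> carrier M"
  shows "t \<odot>\<^bsub>BC\<^esub> base_change_tensor R S \<phi> M s x = base_change_tensor R S \<phi> M (t \<otimes>\<^bsub>S\<^esub> s) x"
  using assms by (simp add: tensor_def BC_smult)

lemma tensor_balanced:
  assumes "s \<in> carrier S" "r \<in> carrier R" "x \<in> carrier M"
  shows "base_change_tensor R S \<phi> M s (r \<odot>\<^bsub>M\<^esub> x) = base_change_tensor R S \<phi> M (s \<otimes>\<^bsub>S\<^esub> \<phi> r) x"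
proof -
  have "frag_of (s \<otimes>\<^bsub>S\<^esub> \<phi> r, x) - frag_of (s, r \<odot>\<^bsub>M\<^esub> x) \<in> K"
    using assms by (intro rels_K) (auto simp: base_change_rels_def)
  then show ?thesis using assms \<phi>_closed by (simp add: tensor_def \<pi>_eq_iff[symmetric])
qed

end

text \<open>Sending \<open>(s, x)\<close> to \<open>(\<sigma> s, x)\<close> respects the relations
  because \<open>\<sigma>\<close> is a ring homomorphism with
  \<open>\<phi>' = \<sigma> \<phi>\<close>. With the Frobenius map as \<open>\<sigma>\<close> this
  gives the passage from exponent \<open>e\<close> to \<open>e + 1\<close>.\<close>

lemma base_change_map:
  fixes R :: "('a, 'b) ring_scheme" and M :: "('a, 'm, 'c) module_scheme"
    and S :: "('s, 't) ring_scheme" and S' :: "('u, 'v) ring_scheme"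
  assumes "base_change_data R M S \<phi>" and "base_change_data R M S' \<phi>'"
    and \<sigma>: "\<sigma> \<in> ring_hom S S'" and \<phi>': "\<And>r. r \<in> carrier R \<Longrightarrow> \<phi>' r = \<sigma> (\<phi> r)"
  obtains h where
    "\<And>u. u \<in> carrier (base_change R S \<phi> M) \<Longrightarrow> h u \<in> carrier (base_change R S' \<phi>' M)"
    "\<And>u v. u \<in> carrier (base_change R S \<phi> M) \<Longrightarrow> v \<in> carrier (base_change R S \<phi> M) \<Longrightarrow>
       h (u \<oplus>\<^bsub>base_change R S \<phi> M\<^esub> v) = h u \<oplus>\<^bsub>base_change R S' \<phi>' M\<^esub> h v"
    "\<And>s u. s \<in> carrier S \<Longrightarrow> u \<in> carrier (base_change R S \<phi> M) \<Longrightarrow>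
       h (s \<odot>\<^bsub>base_change R S \<phi> M\<^esub> u) = \<sigma> s \<odot>\<^bsub>base_change R S' \<phi>' M\<^esub> h u"
    "\<And>s x. s \<in> carrier S \<Longrightarrow> x \<in> carrier M \<Longrightarrow>
       h (base_change_tensor R S \<phi> M s x) = base_change_tensor R S' \<phi>' M (\<sigma> s) x"
proof -
  interpret A: base_change_data R M S \<phi> by fact
  interpret B: base_change_data R M S' \<phi>' by fact
  define \<psi> where "\<psi> = frag_extend (\<lambda>(s, x :: 'm). frag_of (\<sigma> s, x))"
  note [simp] = ring_hom_closed[OF \<sigma>] ring_hom_mult[OF \<sigma>] ring_hom_add[OF \<sigma>] A.\<phi>_closed \<phi>'
  have \<psi>_of [simp]: "\<psi> (frag_of (s, x)) = frag_of (\<sigma> s, x)" for s x by (simp add: \<psi>_def)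
  have \<psi>_zero [simp]: "\<psi> 0 = 0" by (simp add: \<psi>_def)
  have \<psi>_add: "\<psi> (x + y) = \<psi> x + \<psi> y" and \<psi>_diff: "\<psi> (x - y) = \<psi> x - \<psi> y" for x y
    by (simp_all add: \<psi>_def frag_extend_add frag_extend_diff)
  have \<psi>_closed [simp]: "\<psi> c \<in> carrier B.G" if "c \<in> carrier A.G" for c
    using that
  proof (induction c rule: A.G_induct)
    case zero
    then show ?case using B.G.one_closed by simp
  qed (auto simp: \<psi>_diff)
  have \<psi>_K: "\<psi> k \<in> B.K" if "k \<in> A.K" for k
    unfolding \<psi>_def base_change_null_def base_change_free_def
  proof (rule frag_extend_generate)
    show "k \<in> generate (free_Abelian_group (carrier S \<times> carrier M)) (base_change_rels R S \<phi> M)"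
      using that by (simp add: base_change_null_def base_change_free_def)
    fix r assume "r \<in> base_change_rels R S \<phi> M"
    then have "\<psi> r \<in> base_change_rels R S' \<phi>' M"
    proof (unfold base_change_rels_def, elim UnE CollectE exE conjE, goal_cases)
      case (1 t u x)
      then show ?case
        by (intro UnI1 CollectI exI[of _ "\<sigma> t"] exI[of _ "\<sigma> u"] exI[of _ x])
          (simp add: \<psi>_diff \<psi>_add)
    next
      case (2 t x y)
      then show ?case
        by (intro UnI1[OF UnI2] CollectI exI[of _ "\<sigma> t"] exI[of _ x] exI[of _ y])
          (simp add: \<psi>_diff \<psi>_add)
    next
      case (3 t r x)
      then show ?case
        by (intro UnI2 CollectI exI[of _ "\<sigma> t"] exI[of _ r] exI[of _ x]) (simp add: \<psi>_diff)
    qed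
    then show "frag_extend (\<lambda>(s, x). frag_of (\<sigma> s, x)) r
        \<in> generate (free_Abelian_group (carrier S' \<times> carrier M)) (base_change_rels R S' \<phi>' M)"
      by (auto simp: \<psi>_def intro: generate.incl)
  qed (use A.rels_subset[unfolded base_change_free_def] B.rels_subset[unfolded base_change_free_def] in simp_all)
  have hom: "(\<lambda>c. B.\<pi> (\<psi> c)) \<in> hom A.G (B.G Mod B.K)"
  proof (rule homI)
    show "B.\<pi> (\<psi> c) \<in> carrier (B.G Mod B.K)" if "c \<in> carrier A.G" for c
      using \<psi>_closed[OF that] by (auto simp: carrier_FactGroup)
    show "B.\<pi> (\<psi> (c \<otimes>\<^bsub>A.G\<^esub> d)) = B.\<pi> (\<psi> c) \<otimes>\<^bsub>B.G Mod B.K\<^esub> B.\<pi> (\<psi> d)"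
      if "c \<in> carrier A.G" "d \<in> carrier A.G" for c d
      using normal.rcos_sum[OF B.K_normal \<psi>_closed \<psi>_closed, OF that]
      by (simp add: \<psi>_add FactGroup_def)
  qed
  \<comment> \<open>Constancy on cosets comes from \<open>\<psi>_K\<close>, so the composite with
    the projection factors through the quotient.\<close>
  have well: "B.\<pi> (\<psi> x) = B.\<pi> (\<psi> y)"
    if "x \<in> carrier A.G" "y \<in> carrier A.G" "A.\<pi> x = A.\<pi> y" for x y
    using that \<psi>_K[of "x - y"] by (simp add: A.\<pi>_eq_iff B.\<pi>_eq_iff \<psi>_diff)
  obtain h where h: "\<And>x. x \<in> carrier A.G \<Longrightarrow> h (A.\<pi> x) = B.\<pi> (\<psi> x)"
    by (rule FactGroup_universal[OF hom A.K_normal well]) auto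
  have act: "\<psi> (base_change_act S s c) = base_change_act S' (\<sigma> s) (\<psi> c)"
    if s: "s \<in> carrier S" and "c \<in> carrier A.G" for s c
    using that(2) by (induction c rule: A.G_induct)
      (use s in \<open>simp_all add: A.act_diff B.act_diff \<psi>_diff\<close>)
  show thesis
  proof (rule that)
    fix u assume "u \<in> carrier A.BC"
    then obtain c where c: "u = A.\<pi> c" "c \<in> carrier A.G" by (auto simp: A.carrier_BC)
    then show "h u \<in> carrier B.BC" by (simp add: h)
    show "h (s \<odot>\<^bsub>A.BC\<^esub> u) = \<sigma> s \<odot>\<^bsub>B.BC\<^esub> h u" if "s \<in> carrier S" for s
      using that c by (simp add: A.BC_smult B.BC_smult h act)
    fix v assume "v \<in> carrier A.BC"
    then obtain d where d: "v = A.\<pi> d" "d \<in> carrier A.G" by (auto simp: A.carrier_BC)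
    then show "h (u \<oplus>\<^bsub>A.BC\<^esub> v) = h u \<oplus>\<^bsub>B.BC\<^esub> h v"
      using c by (simp add: A.BC_add B.BC_add h \<psi>_add)
  next
    fix s x assume "s \<in> carrier S" "x \<in> carrier M"
    then show "h (base_change_tensor R S \<phi> M s x) = base_change_tensor R S' \<phi>' M (\<sigma> s) x"
      by (simp add: A.tensor_def B.tensor_def h)
  qed
qed

text \<open>Covers two maps: the power map from \<open>M\<close> to its Frobenius base change,
  semilinear over the iterated Frobenius map, and the comparison of consecutive base changes,
  semilinear over the Frobenius map itself.\<close>

locale semilinear_map = M: module R M + M': module S M'
  for R :: "('a, 'b) ring_scheme" and M :: "('a, 'm, 'c) module_scheme"
    and S :: "('s, 't) ring_scheme" and M' :: "('s, 'n, 'd) module_scheme" +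
  fixes \<sigma> :: "'a \<Rightarrow> 's" and f :: "'m \<Rightarrow> 'n"
  assumes \<sigma>_closed: "r \<in> carrier R \<Longrightarrow> \<sigma> r \<in> carrier S"
    and f_closed: "x \<in> carrier M \<Longrightarrow> f x \<in> carrier M'"
    and f_add: "x \<in> carrier M \<Longrightarrow> y \<in> carrier M \<Longrightarrow> f (x \<oplus>\<^bsub>M\<^esub> y) = f x \<oplus>\<^bsub>M'\<^esub> f y"
    and f_smult: "r \<in> carrier R \<Longrightarrow> x \<in> carrier M \<Longrightarrow> f (r \<odot>\<^bsub>M\<^esub> x) = \<sigma> r \<odot>\<^bsub>M'\<^esub> f x"
begin

lemma f_zero: "f \<zero>\<^bsub>M\<^esub> = \<zero>\<^bsub>M'\<^esub>"
  using f_add[of "\<zero>\<^bsub>M\<^esub>" "\<zero>\<^bsub>M\<^esub>"] f_closed[of "\<zero>\<^bsub>M\<^esub>"] M'.add.r_cancel_one'[of "f \<zero>\<^bsub>M\<^esub>" "f \<zero>\<^bsub>M\<^esub>"]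
  by simp

lemma f_minus:
  assumes x: "x \<in> carrier M"
  shows "f (\<ominus>\<^bsub>M\<^esub> x) = \<ominus>\<^bsub>M'\<^esub> f x"
proof -
  have "f (\<ominus>\<^bsub>M\<^esub> x) \<oplus>\<^bsub>M'\<^esub> f x = \<zero>\<^bsub>M'\<^esub>"
    using x f_add[of "\<ominus>\<^bsub>M\<^esub> x" x] by (simp add: M.M.l_neg f_zero)
  then show ?thesis using x by (intro M'.M.minus_equality[symmetric] f_closed) auto
qed

lemma preimage_submodule:
  assumes W: "submodule W S M'"
  shows "submodule {x \<in> carrier M. f x \<in> W} R M"
  using M'.submodule_zero[OF W] M'.submoduleE(3,4,5)[OF W]
  by (intro M.submoduleI) (auto simp: f_zero f_minus f_add f_smult \<sigma>_closed)

text \<open>The preimage of the span of the image of \<open>A\<close> is a submodule containing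
  \<open>A\<close>, hence contains the span of \<open>A\<close>.\<close>

lemma image_gen_subset:
  assumes A: "A \<subseteq> carrier M"
  shows "f ` submodule_gen R M A \<subseteq> submodule_gen S M' (f ` A)"
proof -
  have "submodule (submodule_gen S M' (f ` A)) S M'"
    using A f_closed by (intro M'.submodule_gen_submodule) auto
  then have "submodule_gen R M A \<subseteq> {x \<in> carrier M. f x \<in> submodule_gen S M' (f ` A)}"
    using A M'.submodule_gen_superset[of "f ` A"]
    by (intro M.submodule_gen_minimal preimage_submodule) auto
  then show ?thesis by auto
qed

text \<open>As \<open>\<sigma>\<close> need not be onto, the image of a submodule need not be a
  submodule; therefore spans are taken on both sides.\<close>

lemma gen_image_gen:
  assumes A: "A \<subseteq> carrier M"
  shows "submodule_gen S M' (f ` submodule_gen R M A) = submodule_gen S M' (f ` A)"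
proof
  show "submodule_gen S M' (f ` submodule_gen R M A) \<subseteq> submodule_gen S M' (f ` A)"
    using A f_closed by (intro M'.submodule_gen_minimal image_gen_subset M'.submodule_gen_submodule) auto
  show "submodule_gen S M' (f ` A) \<subseteq> submodule_gen S M' (f ` submodule_gen R M A)"
    by (intro M'.submodule_gen_mono image_mono M.submodule_gen_superset)
qed

end

section \<open>Frobenius powers and F-reductions\<close>

locale prime_char_module = module R M
  for R :: "('a, 'b) ring_scheme" (structure) and M :: "('a, 'm, 'c) module_scheme" (structure) +
  fixes p :: nat
  assumes p: "Factorial_Ring.prime p" and char: "ring_char R = p"
begin

lemma frobenius_hom: "frobenius R p \<in> ring_hom R R"
proof (rule ring_hom_memI)
  show "frobenius R p (x \<oplus> y) = frobenius R p x \<oplus> frobenius R p y"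
    if "x \<in> carrier R" "y \<in> carrier R" for x y
    using R.frobenius_add[OF p char that] .
qed (auto simp: frobenius_def R.nat_pow_distrib)

lemma frobenius_funpow_closed: "r \<in> carrier R \<Longrightarrow> (frobenius R p ^^ e) r \<in> carrier R"
  by (induction e) (auto simp: frobenius_def)

lemma base_change_data_frob: "base_change_data R M R (frobenius R p ^^ e)"
  by unfold_locales (rule frobenius_funpow_closed)

lemma module_frob: "module R (frob_module R p e M)"
  unfolding frob_module_def by (rule base_change_data.module_BC[OF base_change_data_frob])

lemma frob_elem_closed: "x \<in> carrier M \<Longrightarrow> frob_elem R p e M x \<in> carrier (frob_module R p e M)"
  unfolding frob_module_def frob_elem_def
  by (rule base_change_data.tensor_closed[OF base_change_data_frob]) auto

text \<open>With \<open>q = p^e\<close>, a scalar crosses the tensor sign as its \<open>q\<close>-th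
  power: \<open>1 \<otimes> r x = r^q \<otimes> x = r^q (1 \<otimes> x)\<close>.\<close>

lemma frob_elem_semilinear:
  "semilinear_map R M R (frob_module R p e M) (frobenius R p ^^ e) (frob_elem R p e M)"
proof -
  interpret B: base_change_data R M R "frobenius R p ^^ e" by (rule base_change_data_frob)
  have "frob_elem R p e M (r \<odot>\<^bsub>M\<^esub> x) = (frobenius R p ^^ e) r \<odot>\<^bsub>frob_module R p e M\<^esub> frob_elem R p e M x"
    if "r \<in> carrier R" "x \<in> carrier M" for r x
    using that frobenius_funpow_closed[OF that(1), of e] unfolding frob_elem_def frob_module_def
    by (simp add: B.tensor_balanced B.tensor_smult)
  moreover have "frob_elem R p e M (x \<oplus>\<^bsub>M\<^esub> y) = frob_elem R p e M x \<oplus>\<^bsub>frob_module R p e M\<^esub> frob_elem R p e M y"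
    if "x \<in> carrier M" "y \<in> carrier M" for x y
    using that unfolding frob_elem_def frob_module_def by (simp add: B.tensor_add)
  ultimately show ?thesis
    by (intro semilinear_map.intro semilinear_map_axioms.intro module_frob module_axioms
        frobenius_funpow_closed frob_elem_closed) auto
qed

lemma frob_power_submodule:
  "L \<subseteq> carrier M \<Longrightarrow> submodule (frob_power R p e M L) R (frob_module R p e M)"
  unfolding frob_power_def
  by (intro module.submodule_gen_submodule[OF module_frob]) (auto intro: frob_elem_closed)

lemma frob_elem_in_power: "x \<in> L \<Longrightarrow> frob_elem R p e M x \<in> frob_power R p e M L"
  unfolding frob_power_def by (rule subsetD[OF module.submodule_gen_superset[OF module_frob] imageI])

lemma frob_power_subset:
  assumes "L \<subseteq> carrier M" "\<And>x. x \<in> N \<Longrightarrow> frob_elem R p e M x \<in> frob_power R p e M L"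
  shows "frob_power R p e M N \<subseteq> frob_power R p e M L"
  unfolding frob_power_def[of R p e M N]
  by (rule module.submodule_gen_minimal[OF module_frob _ frob_power_submodule]) (use assms in auto)

text \<open>Ties generating sets of a submodule to those of its Frobenius powers, in both
  directions: it bounds the number of generators and recognizes when fewer of them still give the
  same power.\<close>

lemma frob_power_gen:
  "A \<subseteq> carrier M \<Longrightarrow> frob_power R p e M (submodule_gen R M A)
     = submodule_gen R (frob_module R p e M) (frob_elem R p e M ` A)"
  unfolding frob_power_def by (rule semilinear_map.gen_image_gen[OF frob_elem_semilinear])

text \<open>The Frobenius map of \<open>R\<close> induces a semilinear map between consecutive base
  changes that takes \<open>z^q\<close> to \<open>z^(pq)\<close>; membership in the span of powers
  is carried along it.\<close>

lemma frob_power_Suc: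
  assumes L: "L \<subseteq> carrier M" and z: "z \<in> carrier M"
    and "frob_elem R p e M z \<in> frob_power R p e M L"
  shows "frob_elem R p (Suc e) M z \<in> frob_power R p (Suc e) M L"
proof -
  let ?F = "\<lambda>e. frob_module R p e M"
  \<comment> \<open>The next iterate is the Frobenius map after the previous one, the compatibility
    that \<open>base_change_map\<close> asks for.\<close>
  have *: "(frobenius R p ^^ Suc e) r = frobenius R p ((frobenius R p ^^ e) r)" for r by simp
  obtain h where h: "\<And>u. u \<in> carrier (?F e) \<Longrightarrow> h u \<in> carrier (?F (Suc e))"
      "\<And>u v. u \<in> carrier (?F e) \<Longrightarrow> v \<in> carrier (?F e) \<Longrightarrow> h (u \<oplus>\<^bsub>?F e\<^esub> v) = h u \<oplus>\<^bsub>?F (Suc e)\<^esub> h v"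
      "\<And>s u. s \<in> carrier R \<Longrightarrow> u \<in> carrier (?F e) \<Longrightarrow>
         h (s \<odot>\<^bsub>?F e\<^esub> u) = frobenius R p s \<odot>\<^bsub>?F (Suc e)\<^esub> h u"
    and ht: "\<And>s x. s \<in> carrier R \<Longrightarrow> x \<in> carrier M \<Longrightarrow>
         h (base_change_tensor R R (frobenius R p ^^ e) M s x)
           = base_change_tensor R R (frobenius R p ^^ Suc e) M (frobenius R p s) x"
    unfolding frob_module_def
    using base_change_map[OF base_change_data_frob[of e] base_change_data_frob[of "Suc e"] frobenius_hom *]
    by blast
  have he: "h (frob_elem R p e M x) = frob_elem R p (Suc e) M x" if "x \<in> carrier M" for x
    using ht[OF _ that, of \<one>] by (simp add: frob_elem_def frobenius_def)
  interpret h: semilinear_map R "?F e" R "?F (Suc e)" "frobenius R p" h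
    using h by (intro semilinear_map.intro semilinear_map_axioms.intro module_frob)
      (auto simp: frobenius_def)
  have "h (frob_elem R p e M z) \<in> submodule_gen R (?F (Suc e)) (h ` frob_elem R p e M ` L)"
    using assms(3) h.image_gen_subset[of "frob_elem R p e M ` L"] L frob_elem_closed
    unfolding frob_power_def by blast
  moreover have "h ` frob_elem R p e M ` L = frob_elem R p (Suc e) M ` L"
    using he L by (force simp: image_image intro!: image_cong)
  ultimately show ?thesis using he[OF z] by (simp add: frob_power_def)
qed

lemma frob_power_raise:
  assumes "L \<subseteq> carrier M" "z \<in> carrier M" "frob_elem R p e M z \<in> frob_power R p e M L" "e \<le> e'"
  shows "frob_elem R p e' M z \<in> frob_power R p e' M L"
  using assms(4,3) by (induction e' rule: dec_induct) (use assms(1,2) frob_power_Suc in auto)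

section \<open>Frobenius closure and F-reductions\<close>

lemma frob_closure_superset: "L \<subseteq> carrier M \<Longrightarrow> L \<subseteq> frob_closure R p M L"
  using frob_elem_in_power by (auto simp: frob_closure_def)

lemma frob_closure_mono: "L \<subseteq> L' \<Longrightarrow> frob_closure R p M L \<subseteq> frob_closure R p M L'"
proof -
  assume "L \<subseteq> L'"
  then have "frob_power R p e M L \<subseteq> frob_power R p e M L'" for e
    unfolding frob_power_def by (intro module.submodule_gen_mono[OF module_frob] image_mono)
  then show ?thesis by (auto simp: frob_closure_def)
qed

text \<open>An inclusion of Frobenius powers at one exponent \<open>e\<close> persists at all larger
  ones. If \<open>d\<close> witnesses \<open>z\<close> in the closure of \<open>L\<close>, both
  facts can be compared at \<open>max d e\<close>.\<close>

lemma frob_closure_subset: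
  assumes L: "L \<subseteq> carrier M" and L': "L' \<subseteq> carrier M"
    and sub: "frob_power R p e M L \<subseteq> frob_power R p e M L'"
  shows "frob_closure R p M L \<subseteq> frob_closure R p M L'"
proof
  fix z assume "z \<in> frob_closure R p M L"
  then obtain d where z: "z \<in> carrier M" "frob_elem R p d M z \<in> frob_power R p d M L"
    by (auto simp: frob_closure_def)
  let ?m = "max d e"
  have "frob_power R p ?m M L \<subseteq> frob_power R p ?m M L'"
  proof (rule frob_power_subset[OF L'])
    fix x assume "x \<in> L"
    then show "frob_elem R p ?m M x \<in> frob_power R p ?m M L'"
      using frob_power_raise[OF L', of x e ?m] L sub frob_elem_in_power[of x L e] by auto
  qed
  then have "frob_elem R p ?m M z \<in> frob_power R p ?m M L'"
    using frob_power_raise[OF L z, of ?m] by auto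
  then show "z \<in> frob_closure R p M L'" using z by (auto simp: frob_closure_def)
qed

text \<open>Each generator of \<open>N\<close> lies in the closure of \<open>L\<close> with its own
  exponent; finitely many generators admit a common one, and all larger exponents work as
  well.\<close>

lemma F_reduction_frob_power_eq:
  assumes N: "submodule N R M" "fin_gen R M N" and L: "F_reduction R p M N L"
  shows "\<exists>e0. \<forall>e\<ge>e0. frob_power R p e M N = frob_power R p e M L"
proof -
  have Nc: "N \<subseteq> carrier M" using submoduleE(1)[OF N(1)] .
  have LN: "L \<subseteq> N" "frob_closure R p M L = frob_closure R p M N"
    using L by (auto simp: F_reduction_def)
  then have Lc: "L \<subseteq> carrier M" using Nc by blast
  obtain A where A: "A \<subseteq> N" "finite A" "submodule_gen R M A = N"
    using N(2) by (auto simp: fin_gen_def)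
  have "\<forall>a\<in>A. \<exists>e. frob_elem R p e M a \<in> frob_power R p e M L"
    using A(1) frob_closure_superset[OF Nc] LN(2) by (auto simp: frob_closure_def)
  then obtain d where d: "\<And>a. a \<in> A \<Longrightarrow> frob_elem R p (d a) M a \<in> frob_power R p (d a) M L"
    by metis
  \<comment> \<open>The sum bounds every \<open>d a\<close>, and in contrast to a maximum it also
    makes sense for empty \<open>A\<close>.\<close>
  have "frob_power R p e M N = frob_power R p e M L" if e: "sum d A \<le> e" for e
  proof
    have "frob_elem R p e M a \<in> frob_power R p e M L" if a: "a \<in> A" for a
      using a A Nc e member_le_sum[of a A d] by (intro frob_power_raise[OF Lc _ d[OF a]]) auto
    then have "frob_power R p e M A \<subseteq> frob_power R p e M L" by (rule frob_power_subset[OF Lc])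
    moreover have "frob_power R p e M N = frob_power R p e M A"
      using frob_power_gen[of A e] A Nc by (auto simp: frob_power_def)
    ultimately show "frob_power R p e M N \<subseteq> frob_power R p e M L" by simp
    show "frob_power R p e M L \<subseteq> frob_power R p e M N"
      using LN(1) frob_elem_in_power by (intro frob_power_subset[OF Nc]) auto
  qed
  then show ?thesis by blast
qed

lemma min_num_gens_minimal_F_reduction:
  assumes noeth: "noetherian_ring R" and loc: "local_ring R \<mm>"
    and L: "minimal_F_reduction R p M N L" and fin: "fin_gen R M L"
  shows "min_num_gens R M L = min_num_gens R (frob_module R p e M) (frob_power R p e M L)"
proof (rule antisym)
  let ?F = "frob_module R p e M" and ?P = "frob_power R p e M"
  interpret F: module R ?F by (rule module_frob)
  have Ls: "submodule L R M" and LN: "L \<subseteq> N"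
    and cl: "frob_closure R p M L = frob_closure R p M N"
    and min: "\<And>L'. submodule L' R M \<Longrightarrow> L' \<subset> L \<Longrightarrow> \<not> F_reduction R p M N L'"
    using L by (auto simp: minimal_F_reduction_def F_reduction_def)
  have Lc: "L \<subseteq> carrier M" by (rule submoduleE(1)[OF Ls])
  obtain A where A: "A \<subseteq> L" "finite A" "card A = min_num_gens R M L" "submodule_gen R M A = L"
    using min_num_gens_obtain[OF fin] .
  let ?A = "frob_elem R p e M ` A"
  have gen: "submodule_gen R ?F ?A = ?P L"
    using frob_power_gen[of A e] A Lc by auto
  have sub: "?A \<subseteq> ?P L" using A(1) frob_elem_in_power by blast
  have Ac: "?A \<subseteq> carrier ?F" using A(1) Lc frob_elem_closed by blast
  \<comment> \<open>The power map may identify elements of \<open>A\<close>, so the image has at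
    most \<open>card A\<close> elements.\<close>
  show "min_num_gens R ?F (?P L) \<le> min_num_gens R M L"
    using F.min_num_gens_le[OF sub _ gen] A(2,3) card_image_le[OF A(2)]
    by (metis finite_imageI order_trans)
  have "fin_gen R ?F (?P L)" using sub gen A(2) by (auto simp: fin_gen_def)
  then obtain B where B: "B \<subseteq> ?P L" "finite B" "card B = min_num_gens R ?F (?P L)"
      "submodule_gen R ?F B = ?P L"
    by (rule F.min_num_gens_obtain)
  have Bc: "B \<subseteq> carrier ?F"
    using B(1) F.submoduleE(1)[OF frob_power_submodule[OF Lc]] by blast
  \<comment> \<open>\<open>B\<close> supplies only the bound. The exchange keeps the new generators
    among the powers of elements of \<open>A\<close>, so that they can be lifted to
    \<open>L\<close>.\<close>
  obtain A' where A': "A' \<subseteq> ?A" "card A' \<le> card B" "submodule_gen R ?F A' = ?P L"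
    using F.local_exchange[OF noeth loc Ac B(2) Bc] B(4) gen by auto
  \<comment> \<open>One preimage is chosen for each element of \<open>A'\<close>, so that
    \<open>C\<close> is no larger than \<open>A'\<close>.\<close>
  obtain C where C: "C \<subseteq> A" "inj_on (frob_elem R p e M) C" "A' = frob_elem R p e M ` C"
    using A'(1) by (auto simp: subset_image_inj)
  define L' where "L' = submodule_gen R M C"
  have Cc: "C \<subseteq> carrier M" using C A Lc by blast
  have L's: "submodule L' R M" unfolding L'_def by (rule submodule_gen_submodule[OF Cc])
  have L'L: "L' \<subseteq> L" unfolding L'_def using C A by (intro submodule_gen_minimal Ls) auto
  have "?P L' = ?P L" unfolding L'_def using frob_power_gen[OF Cc] A'(3) C(3) by simp
  then have "frob_closure R p M L \<subseteq> frob_closure R p M L'"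
    using Lc L'L by (intro frob_closure_subset[of _ _ e]) auto
  then have "F_reduction R p M N L'"
    using frob_closure_mono[OF L'L] L's L'L LN cl by (auto simp: F_reduction_def)
  then have "L' = L" using min[OF L's] L'L by blast
  \<comment> \<open>Only after minimality has forced \<open>L' = L\<close> does \<open>C\<close>
    count as a generating set of \<open>L\<close>.\<close>
  then have "min_num_gens R M L \<le> card C"
    using C(1) A(1,2) by (intro min_num_gens_le) (auto simp: L'_def finite_subset)
  also have "\<dots> = card A'" using C by (simp add: card_image)
  finally show "min_num_gens R M L \<le> min_num_gens R ?F (?P L)" using A'(2) B(3) by simp
qed

end

theorem proposition4p7:
  fixes R :: "('a, 'b) ring_scheme" and \<mm> :: "'a set" and p :: nat
    and M :: "('a, 'm, 'c) module_scheme" and N :: "'m set"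
  assumes "noetherian_ring R" and "local_ring R \<mm>"
    and "Factorial_Ring.prime p" and "ring_char R = p"
    and "module R M" and "fin_gen R M (carrier M)"
    and "submodule N R M"
  shows "(\<forall>L. minimal_F_reduction R p M N L \<longrightarrow>
            (\<exists>e0. \<forall>e\<ge>e0. min_num_gens R M L =
                min_num_gens R (frob_module R p e M) (frob_power R p e M N))) \<and>
         (\<forall>L1 L2. minimal_F_reduction R p M N L1 \<and> minimal_F_reduction R p M N L2 \<longrightarrow>
            min_num_gens R M L1 = min_num_gens R M L2)"
proof -
  interpret module R M by fact
  interpret prime_char_module R M p using assms(3,4) by unfold_locales
  \<comment> \<open>Needed for \<open>N\<close>, to get a common exponent, and for \<open>L\<close>,
    where \<open>min_num_gens\<close> is otherwise unspecified.\<close>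
  have fin: "fin_gen R M H" if "submodule H R M" for H
    using fin_gen_submodule[OF assms(1,6) that] .
  have main: "\<exists>e0. \<forall>e\<ge>e0. min_num_gens R M L =
      min_num_gens R (frob_module R p e M) (frob_power R p e M N)"
    if L: "minimal_F_reduction R p M N L" for L
  proof -
    have red: "F_reduction R p M N L" using L by (simp add: minimal_F_reduction_def)
    then have "submodule L R M" by (simp add: F_reduction_def)
    then have "min_num_gens R M L = min_num_gens R (frob_module R p e M) (frob_power R p e M L)" for e
      using min_num_gens_minimal_F_reduction[OF assms(1,2) L] fin by blast
    then show ?thesis
      using F_reduction_frob_power_eq[OF assms(7) fin[OF assms(7)] red] by metis
  qed
  have "min_num_gens R M L1 = min_num_gens R M L2"
    if L1: "minimal_F_reduction R p M N L1" and L2: "minimal_F_reduction R p M N L2" for L1 L2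
  proof -
    obtain d e where "\<forall>n\<ge>d. min_num_gens R M L1 =
          min_num_gens R (frob_module R p n M) (frob_power R p n M N)"
      and "\<forall>n\<ge>e. min_num_gens R M L2 =
          min_num_gens R (frob_module R p n M) (frob_power R p n M N)"
      using main[OF L1] main[OF L2] by blast
    \<comment> \<open>Both eventual values are read off at the common exponent
      \<open>max d e\<close>.\<close>
    then show ?thesis by (metis max.cobounded1 max.cobounded2)
  qed
  with main show ?thesis by blast
qed

end
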